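(* Let $\mathscr T=(V,\mathcal E)$ be the directed Cartesian product of locally finite rooted directed trees $\mathscr T_1,\ldots,\mathscr T_d$, of finite joint branching index, and let $(\mathscr M_z,\mathscr H^{\mathfrak s}_{\mathfrak c_a}(\mathscr T))$ be the analytic model of the spherical Cauchy dual $S^{\mathfrak s}_{\boldsymbol\lambda_{\mathfrak c_a}}$ of the Drury-Arveson-type multishift $S_{\boldsymbol\lambda_{\mathfrak c_a}}$ on $\mathscr T$. If $a$ is a positive integer such that $a<d$, then $\mathscr H^{\mathfrak s}_{\mathfrak c_a}(\mathscr T)$ admits the representing measure $\rho_{\mathscr T}\times\nu_{\mathscr T}=(\rho_u\times\nu_u)_{u\in\Omega_F,F\in\mathscr P}$. In this case, for $u\in\Omega_F$ and $F\in\mathscr P$, the positive scalar-valued measures $\rho_u$ and $\nu_u$ are given by $$d\rho_u(s)=\omega_{|\mathsf d_u|}(s)\,dm(s),\qquad d\nu_u(z)=\frac{|z^{\mathsf d_u}|^2}{\|z^{\mathsf d_u}\|^2_{L^2(\partial\mathbb B^d,\sigma)}}\,d\sigma(z),$$ where $m$ is the Lebesgue measure on $[0,1]$, $\sigma$ is the normalized surface area measure on $\partial\mathbb B^d$, and $$\omega_l(s)=(l+a)\cdots(l+d-1)\sum_{i=a}^{d-1}\frac{s^{i+l-1}}{\prod_{a\leq j\neq i\leq d-1}(j-i)},\quad s\in[0,1],\ l\in\mathbb N.$$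
   Context: Conventions: $\mathbb N=\{0,1,2,\ldots\}$; for $\alpha\in\mathbb N^d$, $\alpha!=\prod_j\alpha_j!$ and $|\alpha|=\sum_j\alpha_j$; empty products are $1$. $\mathscr P$ is the set of all subsets of $\{1,\ldots,d\}$. $\mathbb B^d$ and $\partial\mathbb B^d$ are the unit ball and unit sphere of $\mathbb C^d$. Trees: a rooted directed tree is a connected directed graph without circuits in which every vertex has at most one parent and exactly one vertex (the root) has no parent. $\mathsf{Chi}(u)$ is the set of children of $u$; for a non-root $u$, $\mathsf{par}(u)$ is its parent and $\mathsf{sib}(u)=\mathsf{Chi}(\mathsf{par}(u))$ (so $u\in\mathsf{sib}(u)$). All directed trees are assumed countably infinite and leafless (every vertex has at least one child). Locally finite: every $\mathsf{Chi}(u)$ is finite. The depth of $u$ is the length of the path from the root to $u$. Products: for rooted directed trees $\mathscr T_j=(V_j,\mathcal E_j)$ with roots $\mathsf{root}_j$, the directed Cartesian product $\mathscr T=(V,\mathcal E)$ has $V=V_1\times\cdots\times V_d$ and $(v,w)\in\mathcal E$ iff there is $k$ with $v_j=w_j$ for $j\neq k$ and $(v_k,w_k)\in\mathcal E_k$. Put $\mathsf{root}=(\mathsf{root}_1,\ldots,\mathsf{root}_d)$. The depth of $v\in V$ is $\mathsf d_v=(\mathsf d_{v_1},\ldots,\mathsf d_{v_d})$, $\mathsf d_{v_j}$ being the depth of $v_j$ in $\mathscr T_j$. $\mathsf{Chi}_j(v)$ (resp. $\mathsf{sib}_j(v)$, for $v_j\neq\mathsf{root}_j$) is the set of $w\in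 V$ with $w_i=v_i$ for $i\ne j$ and $w_j\in\mathsf{Chi}(v_j)$ (resp. $w_j\in\mathsf{sib}(v_j)$). $\mathscr T$ is of finite joint branching index if, for each $j$, the set of depths of the branching vertices of $\mathscr T_j$ (vertices with at least two children) is bounded (possibly empty). Multishifts: for $a>0$ put $\lambda_j(w)=\frac{1}{\sqrt{\mathrm{card}(\mathsf{Chi}_j(v))}}\sqrt{\frac{\mathsf d_{v_j}+1}{|\mathsf d_v|+a}}$ for $w\in\mathsf{Chi}_j(v)$, $v\in V$, $j=1,\ldots,d$. On $l^2(V)$ with orthonormal basis $\{e_v\}_{v\in V}$ of indicator functions, the Drury-Arveson-type multishift $S_{\boldsymbol\lambda_{\mathfrak c_a}}=(S_1,\ldots,S_d)$ is given by $S_je_v=\sum_{w\in\mathsf{Chi}_j(v)}\lambda_j(w)e_w$. Its spherical Cauchy dual $S^{\mathfrak s}_{\boldsymbol\lambda_{\mathfrak c_a}}=(S_1^{\mathfrak s},\ldots,S_d^{\mathfrak s})$ is the commuting multishift $S_j^{\mathfrak s}e_v=\big(\sum_{i=1}^d\|S_ie_v\|^2\big)^{-1}\sum_{w\in\mathsf{Chi}_j(v)}\lambda_j(w)e_w$. The joint kernels of the adjoints of $S_{\boldsymbol\lambda_{\mathfrak c_a}}$ and $S^{\mathfrak s}_{\boldsymbol\lambda_{\mathfrak c_a}}$ coincide; put $E=\bigcap_{j=1}^d\ker S_j^*=\bigcap_{j=1}^d\ker (S_j^{\mathfrak s})^*$. Spaces $\mathcal L_{u,F}$: for $F\in\mathscr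 P$ let $\Phi_F=\{v\in V: v_j\neq\mathsf{root}_j\text{ if }j\in F,\ v_j=\mathsf{root}_j\text{ if }j\notin F\}$. For $u\in\Phi_F$, $\mathsf{sib}_F(u)$ is the set of $w\in V$ with $w_j\in\mathsf{sib}(u_j)$ for $j\in F$ and $w_j=u_j$ for $j\notin F$. These sets partition $\Phi_F$, and $\Omega_F$ is any set containing exactly one element of each class. For $G\in\mathscr P$, $v_G$ is $v$ with all coordinates $v_j$, $j\notin G$, replaced by $\mathsf{root}_j$; $\mathsf{sib}_{F,G}(u)=\{v_G: v\in\mathsf{sib}_F(u)\}$ for $G\subseteq F$; for $j\notin G$, $v_G|u_j$ is $v_G$ with $j$-th coordinate replaced by $u_j$. $\mathcal L_{u,F}\subseteq l^2(\mathsf{sib}_F(u))$ is the space of $f$ with $\sum_{w\in\mathsf{sib}_j(v_G|u_j)}f(w)\lambda_j(w)=0$ for all $j\in F$, $G=F\setminus\{j\}$, $v_G\in\mathsf{sib}_{F,G}(u)$ ($\mathcal L_{\mathsf{root},\emptyset}$ is the span of $e_{\mathsf{root}}$). One has $E=\bigoplus_{F\in\mathscr P}\bigoplus_{u\in\Omega_F}\mathcal L_{u,F}$, and $E$ is finite dimensional under finite joint branching index. Analytic model: $\mathscr H^{\mathfrak s}_{\mathfrak c_a}(\mathscr T)$ is the Hilbert space of $E$-valued power series $f(z)=\sum_{\alpha\in\mathbb N^d}f_\alpha z^\alpha$, $f_\alpha\in E$, with $\|f\|^2=\sum_\alpha\|(S^{\mathfrak s}_{\boldsymbol\lambda_{\mathfrak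 c_a}})^\alpha f_\alpha\|^2_{l^2(V)}<\infty$ (holomorphic functions on $\mathbb B^d$), and $\mathscr M_z$ is the $d$-tuple of multiplications by coordinate functions, unitarily equivalent to $S^{\mathfrak s}_{\boldsymbol\lambda_{\mathfrak c_a}}$. $E$ is identified with the constant functions. Representing measure: a Hilbert space $\mathscr H$ of this kind admits a representing measure if there exists a $B(E)$-valued product measure $\rho_{\mathscr T}\times\nu_{\mathscr T}=(\rho_u\times\nu_u)_{u\in\Omega_F,F\in\mathscr P}$ supported on $[0,b]\times\partial\mathbb B^d$, $b>0$, such that: (1) for any $f\in E$ and $\alpha\in\mathbb N^d$, $\|z^\alpha f\|^2_{\mathscr H}=\int_{[0,b]}\int_{\partial\mathbb B^d}s^{|\alpha|}|z^\alpha|^2\langle d\rho_{\mathscr T}(s)\times d\nu_{\mathscr T}(z)f,f\rangle$; (2) $\rho_u$ and $\nu_u$ are scalar-valued measures such that for $g_{u,F}\in\mathcal L_{u,F}$, $d\rho_{\mathscr T}(s)\times d\nu_{\mathscr T}(z)\big(\sum_F\sum_{u\in\Omega_F}g_{u,F}\big)=\sum_F\sum_{u\in\Omega_F}d\rho_u(s)\,d\nu_u(z)\,g_{u,F}$; (3) $\rho_{\mathsf{root}}$ and $\nu_{\mathsf{root}}$ are probability measures. *)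

theory Defs
  imports
    "Graph_Theory.Pair_Digraph"
    "Graph_Theory.Digraph_Component"
    "HOL-Analysis.Analysis"
    "HOL-Probability.Probability_Measure"
begin

section \<open>Rooted directed trees\<close>

definition children :: "'v pair_pre_digraph \<Rightarrow> 'v \<Rightarrow> 'v set" where
  "children G u = {w. (u, w) \<in> parcs G}"

definition parents :: "'v pair_pre_digraph \<Rightarrow> 'v \<Rightarrow> 'v set" where
  "parents G w = {u. (u, w) \<in> parcs G}"

text \<open>\<^const>\<open>Digraph_Component.connected\<close> is weak connectedness, i.e. connectedness of the
  symmetrised graph; acyclicity of the arc relation says that there are no circuits (and no loops).\<close>

definition rooted_directed_tree :: "'v pair_pre_digraph \<Rightarrow> bool" where
  "rooted_directed_tree G \<longleftrightarrow>
     pair_wf_digraph G \<and>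
     Digraph_Component.connected (with_proj G) \<and>
     acyclic (parcs G) \<and>
     (\<forall>w\<in>pverts G. \<forall>u\<in>parents G w. \<forall>u'\<in>parents G w. u = u') \<and>
     (\<exists>!r. r \<in> pverts G \<and> parents G r = {})"

definition countably_infinite_tree :: "'v pair_pre_digraph \<Rightarrow> bool" where
  "countably_infinite_tree G \<longleftrightarrow> countable (pverts G) \<and> infinite (pverts G)"

definition leafless :: "'v pair_pre_digraph \<Rightarrow> bool" where
  "leafless G \<longleftrightarrow> (\<forall>u\<in>pverts G. children G u \<noteq> {})"

definition locally_finite :: "'v pair_pre_digraph \<Rightarrow> bool" where
  "locally_finite G \<longleftrightarrow> (\<forall>u\<in>pverts G. finite (children G u))"

definition tree_root :: "'v pair_pre_digraph \<Rightarrow> 'v" where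
  "tree_root G = (THE r. r \<in> pverts G \<and> parents G r = {})"

definition parent :: "'v pair_pre_digraph \<Rightarrow> 'v \<Rightarrow> 'v" where
  "parent G w = (THE u. u \<in> parents G w)"

definition siblings :: "'v pair_pre_digraph \<Rightarrow> 'v \<Rightarrow> 'v set" where
  "siblings G u = children G (parent G u)"

definition depth :: "'v pair_pre_digraph \<Rightarrow> 'v \<Rightarrow> nat" where
  "depth G u = (THE n. (tree_root G, u) \<in> parcs G ^^ n)"

definition branching_vertices :: "'v pair_pre_digraph \<Rightarrow> 'v set" where
  "branching_vertices G = {u \<in> pverts G. \<exists>w\<in>children G u. \<exists>w'\<in>children G u. w \<noteq> w'}"


section \<open>Directed Cartesian products\<close>

text \<open>A \<open>d\<close>-tuple of trees is a family indexed by a finite type \<open>'d\<close> with \<open>d = CARD('d)\<close>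
  elements; multi-indices are functions \<open>'d \<Rightarrow> nat\<close>.\<close>

definition directed_product ::
    "('d \<Rightarrow> 'v pair_pre_digraph) \<Rightarrow> ('d \<Rightarrow> 'v) pair_pre_digraph" where
  "directed_product T =
     \<lparr> pverts = {v. \<forall>j. v j \<in> pverts (T j)},
       parcs = {(v, w). (\<forall>j. v j \<in> pverts (T j)) \<and> (\<forall>j. w j \<in> pverts (T j)) \<and>
                  (\<exists>k. (\<forall>j. j \<noteq> k \<longrightarrow> v j = w j) \<and> (v k, w k) \<in> parcs (T k))} \<rparr>"

abbreviation vertices :: "('d \<Rightarrow> 'v pair_pre_digraph) \<Rightarrow> ('d \<Rightarrow> 'v) set" where
  "vertices T \<equiv> pverts (directed_product T)"

definition finite_joint_branching_index :: "('d \<Rightarrow> 'v pair_pre_digraph) \<Rightarrow> bool" where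
  "finite_joint_branching_index T \<longleftrightarrow>
     (\<forall>j. bdd_above (depth (T j) ` branching_vertices (T j)))"

definition prod_root :: "('d \<Rightarrow> 'v pair_pre_digraph) \<Rightarrow> ('d \<Rightarrow> 'v)" where
  "prod_root T = (\<lambda>j. tree_root (T j))"

definition prod_depth :: "('d \<Rightarrow> 'v pair_pre_digraph) \<Rightarrow> ('d \<Rightarrow> 'v) \<Rightarrow> ('d \<Rightarrow> nat)" where
  "prod_depth T v = (\<lambda>j. depth (T j) (v j))"

definition Chi :: "('d \<Rightarrow> 'v pair_pre_digraph) \<Rightarrow> 'd \<Rightarrow> ('d \<Rightarrow> 'v) \<Rightarrow> ('d \<Rightarrow> 'v) set" where
  "Chi T j v = {w \<in> vertices T. (\<forall>i. i \<noteq> j \<longrightarrow> w i = v i) \<and> w j \<in> children (T j) (v j)}"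

definition Sib :: "('d \<Rightarrow> 'v pair_pre_digraph) \<Rightarrow> 'd \<Rightarrow> ('d \<Rightarrow> 'v) \<Rightarrow> ('d \<Rightarrow> 'v) set" where
  "Sib T j v = {w \<in> vertices T. (\<forall>i. i \<noteq> j \<longrightarrow> w i = v i) \<and> w j \<in> siblings (T j) (v j)}"

definition multi_abs :: "('d::finite \<Rightarrow> nat) \<Rightarrow> nat" where
  "multi_abs \<alpha> = (\<Sum>j\<in>UNIV. \<alpha> j)"


section \<open>The space of square-summable functions on a set\<close>

text \<open>Functions on \<open>V\<close> are extended by zero outside \<open>V\<close>.\<close>

definition l2 :: "'x set \<Rightarrow> ('x \<Rightarrow> complex) set" where
  "l2 V = {f. (\<forall>v. v \<notin> V \<longrightarrow> f v = 0) \<and> (\<lambda>v. (cmod (f v))\<^sup>2) summable_on V}"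

definition l2_inner :: "'x set \<Rightarrow> ('x \<Rightarrow> complex) \<Rightarrow> ('x \<Rightarrow> complex) \<Rightarrow> complex" where
  "l2_inner V f g = (\<Sum>\<^sub>\<infinity>v\<in>V. f v * cnj (g v))"

definition l2_norm :: "'x set \<Rightarrow> ('x \<Rightarrow> complex) \<Rightarrow> real" where
  "l2_norm V f = sqrt (\<Sum>\<^sub>\<infinity>v\<in>V. (cmod (f v))\<^sup>2)"

definition l2_basis :: "'x \<Rightarrow> ('x \<Rightarrow> complex)" where
  "l2_basis v = (\<lambda>x. if x = v then 1 else 0)"

text \<open>The operator mapping \<open>l2_basis v\<close> to \<open>A v\<close> for \<open>v \<in> V\<close>. For the multishifts below, every
  coordinate of the image is a sum with at most one nonzero term.\<close>

definition op_of_basis ::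
    "'x set \<Rightarrow> ('x \<Rightarrow> 'x \<Rightarrow> complex) \<Rightarrow> ('x \<Rightarrow> complex) \<Rightarrow> ('x \<Rightarrow> complex)" where
  "op_of_basis V A f = (\<lambda>x. \<Sum>\<^sub>\<infinity>v\<in>V. f v * A v x)"

definition l2_adjoint ::
    "'x set \<Rightarrow> (('x \<Rightarrow> complex) \<Rightarrow> ('x \<Rightarrow> complex)) \<Rightarrow> ('x \<Rightarrow> complex) \<Rightarrow> ('x \<Rightarrow> complex)" where
  "l2_adjoint V S f =
     (THE h. h \<in> l2 V \<and> (\<forall>g\<in>l2 V. l2_inner V (S g) f = l2_inner V g h))"

text \<open>\<open>S\<^sup>\<alpha>\<close> for a commuting tuple \<open>S\<close>; the order in which the fold composes the factors is
  irrelevant because the \<open>S j\<close> commute.\<close>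

definition tuple_power :: "('d::finite \<Rightarrow> 'f \<Rightarrow> 'f) \<Rightarrow> ('d \<Rightarrow> nat) \<Rightarrow> 'f \<Rightarrow> 'f" where
  "tuple_power S \<alpha> = Finite_Set.fold (\<lambda>j A. (S j ^^ \<alpha> j) \<circ> A) id UNIV"


section \<open>Drury-Arveson-type multishifts and their spherical Cauchy duals\<close>

text \<open>The weight \<open>\<lambda>\<^sub>j(w)\<close>: the vertex \<open>v\<close> with \<open>w \<in> Chi T j v\<close> is \<open>w\<close> with its \<open>j\<close>-th coordinate
  replaced by the parent. The value is meaningful only when \<open>w j\<close> is not a root.\<close>

definition weight ::
    "('d::finite \<Rightarrow> 'v pair_pre_digraph) \<Rightarrow> real \<Rightarrow> 'd \<Rightarrow> ('d \<Rightarrow> 'v) \<Rightarrow> real" where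
  "weight T a j w =
     (let v = w(j := parent (T j) (w j)) in
        1 / sqrt (real (card (Chi T j v))) *
        sqrt ((real (prod_depth T v j) + 1) / (real (multi_abs (prod_depth T v)) + a)))"

definition shift_on_basis ::
    "('d::finite \<Rightarrow> 'v pair_pre_digraph) \<Rightarrow> real \<Rightarrow> 'd \<Rightarrow> ('d \<Rightarrow> 'v) \<Rightarrow> (('d \<Rightarrow> 'v) \<Rightarrow> complex)" where
  "shift_on_basis T a j v =
     (\<lambda>x. \<Sum>w\<in>Chi T j v. complex_of_real (weight T a j w) * l2_basis w x)"

definition DA_shift ::
    "('d::finite \<Rightarrow> 'v pair_pre_digraph) \<Rightarrow> real \<Rightarrow> 'd
      \<Rightarrow> (('d \<Rightarrow> 'v) \<Rightarrow> complex) \<Rightarrow> (('d \<Rightarrow> 'v) \<Rightarrow> complex)" where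
  "DA_shift T a j = op_of_basis (vertices T) (shift_on_basis T a j)"

definition cauchy_dual ::
    "('d::finite \<Rightarrow> 'v pair_pre_digraph) \<Rightarrow> real \<Rightarrow> 'd
      \<Rightarrow> (('d \<Rightarrow> 'v) \<Rightarrow> complex) \<Rightarrow> (('d \<Rightarrow> 'v) \<Rightarrow> complex)" where
  "cauchy_dual T a j = op_of_basis (vertices T)
     (\<lambda>v x. complex_of_real
              (inverse (\<Sum>i\<in>UNIV. (l2_norm (vertices T) (DA_shift T a i (l2_basis v)))\<^sup>2))
            * shift_on_basis T a j v x)"

definition joint_kernel ::
    "('d::finite \<Rightarrow> 'v pair_pre_digraph) \<Rightarrow> real \<Rightarrow> (('d \<Rightarrow> 'v) \<Rightarrow> complex) set" where
  "joint_kernel T a =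
     {f \<in> l2 (vertices T). \<forall>j. l2_adjoint (vertices T) (DA_shift T a j) f = (\<lambda>_. 0)}"


section \<open>The building blocks of the joint kernel\<close>

definition Phi :: "('d \<Rightarrow> 'v pair_pre_digraph) \<Rightarrow> 'd set \<Rightarrow> ('d \<Rightarrow> 'v) set" where
  "Phi T F = {v \<in> vertices T. (\<forall>j\<in>F. v j \<noteq> tree_root (T j)) \<and> (\<forall>j. j \<notin> F \<longrightarrow> v j = tree_root (T j))}"

definition Sib_set ::
    "('d \<Rightarrow> 'v pair_pre_digraph) \<Rightarrow> 'd set \<Rightarrow> ('d \<Rightarrow> 'v) \<Rightarrow> ('d \<Rightarrow> 'v) set" where
  "Sib_set T F u =
     {w \<in> vertices T. (\<forall>j\<in>F. w j \<in> siblings (T j) (u j)) \<and> (\<forall>j. j \<notin> F \<longrightarrow> w j = u j)}"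

text \<open>\<open>restrict_root T G v\<close> is \<open>v\<^sub>G\<close>.\<close>

definition restrict_root ::
    "('d \<Rightarrow> 'v pair_pre_digraph) \<Rightarrow> 'd set \<Rightarrow> ('d \<Rightarrow> 'v) \<Rightarrow> ('d \<Rightarrow> 'v)" where
  "restrict_root T G v = (\<lambda>j. if j \<in> G then v j else tree_root (T j))"

definition Sib_restrict ::
    "('d \<Rightarrow> 'v pair_pre_digraph) \<Rightarrow> 'd set \<Rightarrow> 'd set \<Rightarrow> ('d \<Rightarrow> 'v) \<Rightarrow> ('d \<Rightarrow> 'v) set" where
  "Sib_restrict T F G u = restrict_root T G ` Sib_set T F u"

definition kernel_block ::
    "('d::finite \<Rightarrow> 'v pair_pre_digraph) \<Rightarrow> real \<Rightarrow> ('d \<Rightarrow> 'v) \<Rightarrow> 'd set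
      \<Rightarrow> (('d \<Rightarrow> 'v) \<Rightarrow> complex) set" where
  "kernel_block T a u F =
     {f \<in> l2 (Sib_set T F u).
        \<forall>j\<in>F. \<forall>vG\<in>Sib_restrict T F (F - {j}) u.
          (\<Sum>w\<in>Sib T j (vG(j := u j)). f w * complex_of_real (weight T a j w)) = 0}"

definition class_representatives ::
    "('d \<Rightarrow> 'v pair_pre_digraph) \<Rightarrow> ('d set \<Rightarrow> ('d \<Rightarrow> 'v) set) \<Rightarrow> bool" where
  "class_representatives T \<Omega> \<longleftrightarrow>
     (\<forall>F. \<Omega> F \<subseteq> Phi T F \<and> (\<forall>v\<in>Phi T F. \<exists>!u. u \<in> \<Omega> F \<inter> Sib_set T F v))"


section \<open>The analytic model\<close>

text \<open>A power series \<open>\<Sum>\<^sub>\<alpha> f\<^sub>\<alpha> z\<^sup>\<alpha>\<close> with coefficients in the joint kernel is represented by its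
  coefficient family \<open>\<alpha> \<mapsto> f\<^sub>\<alpha>\<close>.\<close>

type_synonym ('d, 'v) series = "('d \<Rightarrow> nat) \<Rightarrow> (('d \<Rightarrow> 'v) \<Rightarrow> complex)"

definition model_space ::
    "('d::finite \<Rightarrow> 'v pair_pre_digraph) \<Rightarrow> real \<Rightarrow> ('d, 'v) series set" where
  "model_space T a =
     {\<phi>. (\<forall>\<alpha>. \<phi> \<alpha> \<in> joint_kernel T a) \<and>
          (\<lambda>\<alpha>. (l2_norm (vertices T) (tuple_power (cauchy_dual T a) \<alpha> (\<phi> \<alpha>)))\<^sup>2) summable_on UNIV}"

definition model_norm ::
    "('d::finite \<Rightarrow> 'v pair_pre_digraph) \<Rightarrow> real \<Rightarrow> ('d, 'v) series \<Rightarrow> real" where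
  "model_norm T a \<phi> =
     sqrt (\<Sum>\<^sub>\<infinity>\<alpha>. (l2_norm (vertices T) (tuple_power (cauchy_dual T a) \<alpha> (\<phi> \<alpha>)))\<^sup>2)"

definition const_series :: "(('d \<Rightarrow> 'v) \<Rightarrow> complex) \<Rightarrow> ('d, 'v) series" where
  "const_series f = (\<lambda>\<alpha>. if \<alpha> = (\<lambda>_. 0) then f else (\<lambda>_. 0))"

text \<open>Multiplication by the coordinate function \<open>z\<^sub>j\<close>.\<close>

definition mult_z :: "'d \<Rightarrow> ('d, 'v) series \<Rightarrow> ('d, 'v) series" where
  "mult_z j \<phi> = (\<lambda>\<alpha>. if \<alpha> j = 0 then (\<lambda>_. 0) else \<phi> (\<alpha>(j := \<alpha> j - 1)))"

text \<open>\<open>monomial_series \<alpha> f\<close> is \<open>z\<^sup>\<alpha> f\<close>, with \<open>f\<close> identified with a constant function.\<close>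

definition monomial_series ::
    "('d::finite \<Rightarrow> nat) \<Rightarrow> (('d \<Rightarrow> 'v) \<Rightarrow> complex) \<Rightarrow> ('d, 'v) series" where
  "monomial_series \<alpha> f = tuple_power mult_z \<alpha> (const_series f)"


section \<open>Representing measures\<close>

definition zpow :: "complex ^ 'd \<Rightarrow> ('d::finite \<Rightarrow> nat) \<Rightarrow> complex" where
  "zpow z \<alpha> = (\<Prod>j\<in>UNIV. (z $ j) ^ \<alpha> j)"

text \<open>Positive \<open>B(E)\<close>-valued Borel measures, for a subspace \<open>E\<close> of \<open>l2 V\<close>; operators are
  functions of which only the restriction to \<open>E\<close> is relevant. Countable additivity is meant
  in the weak operator topology.\<close>

definition operator_measure ::
    "'x set \<Rightarrow> ('x \<Rightarrow> complex) set
      \<Rightarrow> ('s::topological_space set \<Rightarrow> ('x \<Rightarrow> complex) \<Rightarrow> ('x \<Rightarrow> complex)) \<Rightarrow> bool" where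
  "operator_measure V E \<mu> \<longleftrightarrow>
     (\<forall>A\<in>sets borel.
        (\<forall>f\<in>E. \<mu> A f \<in> E) \<and>
        (\<forall>f\<in>E. \<forall>g\<in>E. \<mu> A (\<lambda>v. f v + g v) = (\<lambda>v. \<mu> A f v + \<mu> A g v)) \<and>
        (\<forall>c. \<forall>f\<in>E. \<mu> A (\<lambda>v. c * f v) = (\<lambda>v. c * \<mu> A f v)) \<and>
        (\<exists>C. \<forall>f\<in>E. l2_norm V (\<mu> A f) \<le> C * l2_norm V f) \<and>
        (\<forall>f\<in>E. Im (l2_inner V (\<mu> A f) f) = 0 \<and> 0 \<le> Re (l2_inner V (\<mu> A f) f))) \<and>
     (\<forall>f\<in>E. \<mu> {} f = (\<lambda>_. 0)) \<and>
     (\<forall>A :: nat \<Rightarrow> 's set. range A \<subseteq> sets borel \<longrightarrow> disjoint_family A \<longrightarrow>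
        (\<forall>f\<in>E. \<forall>g\<in>E. (\<lambda>n. l2_inner V (\<mu> (A n) f) g) sums l2_inner V (\<mu> (\<Union>n. A n) f) g))"

definition operator_measure_supported ::
    "('x \<Rightarrow> complex) set
      \<Rightarrow> ('s::topological_space set \<Rightarrow> ('x \<Rightarrow> complex) \<Rightarrow> ('x \<Rightarrow> complex)) \<Rightarrow> 's set \<Rightarrow> bool" where
  "operator_measure_supported E \<mu> K \<longleftrightarrow>
     (\<forall>A\<in>sets borel. A \<inter> K = {} \<longrightarrow> (\<forall>f\<in>E. \<mu> A f = (\<lambda>_. 0)))"

text \<open>The scalar measure \<open>\<langle>d\<mu> f, f\<rangle>\<close>.\<close>

definition quadratic_measure ::
    "'x set \<Rightarrow> ('s::topological_space set \<Rightarrow> ('x \<Rightarrow> complex) \<Rightarrow> ('x \<Rightarrow> complex))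
      \<Rightarrow> ('x \<Rightarrow> complex) \<Rightarrow> 's measure" where
  "quadratic_measure V \<mu> f =
     measure_of UNIV (sets borel) (\<lambda>A. ennreal (Re (l2_inner V (\<mu> A f) f)))"

text \<open>The blocks of the joint kernel have pairwise disjoint supports, so that the pointwise sums
  over \<open>\<Omega> F\<close> below have at most one nonzero term at each vertex.\<close>

definition block_sum ::
    "('d::finite set \<Rightarrow> ('d \<Rightarrow> 'v) set) \<Rightarrow> ('d set \<Rightarrow> ('d \<Rightarrow> 'v) \<Rightarrow> (('d \<Rightarrow> 'v) \<Rightarrow> complex))
      \<Rightarrow> (('d \<Rightarrow> 'v) \<Rightarrow> complex)" where
  "block_sum \<Omega> g = (\<lambda>v. \<Sum>F\<in>UNIV. \<Sum>\<^sub>\<infinity>u\<in>\<Omega> F. g F u v)"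

text \<open>The sets \<open>\<Omega> F\<close> are pairwise disjoint, so the families \<open>\<rho>\<^sub>u\<close> and \<open>\<nu>\<^sub>u\<close> are indexed by \<open>u\<close>
  alone. \<open>\<mu>\<close> is the operator-valued product measure assembled from them.\<close>

definition representing_measure ::
    "('d::finite \<Rightarrow> 'v pair_pre_digraph) \<Rightarrow> real \<Rightarrow> ('d set \<Rightarrow> ('d \<Rightarrow> 'v) set)
      \<Rightarrow> (('d \<Rightarrow> 'v) \<Rightarrow> real measure) \<Rightarrow> (('d \<Rightarrow> 'v) \<Rightarrow> (complex ^ 'd) measure) \<Rightarrow> bool" where
  "representing_measure T a \<Omega> \<rho> \<nu> \<longleftrightarrow>
     (\<forall>F. \<forall>u\<in>\<Omega> F. sets (\<rho> u) = sets borel \<and> finite_measure (\<rho> u) \<and>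
                   sets (\<nu> u) = sets borel \<and> finite_measure (\<nu> u)) \<and>
     (\<exists>b>0. \<exists>\<mu> :: (real \<times> (complex ^ 'd)) set
                 \<Rightarrow> (('d \<Rightarrow> 'v) \<Rightarrow> complex) \<Rightarrow> (('d \<Rightarrow> 'v) \<Rightarrow> complex).
        operator_measure (vertices T) (joint_kernel T a) \<mu> \<and>
        operator_measure_supported (joint_kernel T a) \<mu> ({0..b} \<times> sphere 0 1) \<and>
        (\<forall>f\<in>joint_kernel T a. \<forall>\<alpha>.
           monomial_series \<alpha> f \<in> model_space T a \<and>
           ennreal ((model_norm T a (monomial_series \<alpha> f))\<^sup>2) =
             (\<integral>\<^sup>+ p \<in> {0..b} \<times> sphere 0 1.
                ennreal (fst p ^ multi_abs \<alpha> * (cmod (zpow (snd p) \<alpha>))\<^sup>2)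
              \<partial>quadratic_measure (vertices T) \<mu> f)) \<and>
        (\<forall>A\<in>sets borel. \<forall>g. (\<forall>F. \<forall>u\<in>\<Omega> F. g F u \<in> kernel_block T a u F) \<longrightarrow>
           \<mu> A (block_sum \<Omega> g) =
             block_sum \<Omega> (\<lambda>F u v. complex_of_real (measure (\<rho> u \<Otimes>\<^sub>M \<nu> u) A) * g F u v)) \<and>
        prob_space (\<rho> (prod_root T)) \<and> prob_space (\<nu> (prod_root T)))"


section \<open>The explicit measures\<close>

definition unit_lebesgue :: "real measure" where
  "unit_lebesgue = density lborel (indicator {0..1})"

text \<open>Normalized surface area measure on the unit sphere, as a Borel measure on the whole space:
  the measure of a Borel subset \<open>A\<close> of the sphere is the normalized volume of the part of the cone
  over \<open>A\<close> that lies in the unit ball. Note that \<open>sgn z = z /\<^sub>R norm z\<close>; the centre of the ball,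
  where this fails to be on the sphere, is a null set.\<close>

definition sphere_measure :: "(complex ^ 'd::finite) measure" where
  "sphere_measure = distr (uniform_measure lborel (ball 0 1)) borel sgn"

text \<open>The exponent \<open>i + l - 1\<close> is not truncated, as \<open>i \<ge> a \<ge> 1\<close>.\<close>

definition omega :: "nat \<Rightarrow> nat \<Rightarrow> nat \<Rightarrow> real \<Rightarrow> real" where
  "omega d a l s =
     (\<Prod>k\<in>{a..d-1}. real l + real k) *
     (\<Sum>i\<in>{a..d-1}. s ^ (i + l - 1) / (\<Prod>j\<in>{a..d-1} - {i}. real j - real i))"

definition radial_measure ::
    "('d::finite \<Rightarrow> 'v pair_pre_digraph) \<Rightarrow> nat \<Rightarrow> ('d \<Rightarrow> 'v) \<Rightarrow> real measure" where
  "radial_measure T a u =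
     density unit_lebesgue (\<lambda>s. ennreal (omega CARD('d) a (multi_abs (prod_depth T u)) s))"

definition spherical_measure ::
    "('d::finite \<Rightarrow> 'v pair_pre_digraph) \<Rightarrow> ('d \<Rightarrow> 'v) \<Rightarrow> (complex ^ 'd) measure" where
  "spherical_measure T u =
     density sphere_measure
       (\<lambda>z. ennreal ((cmod (zpow z (prod_depth T u)))\<^sup>2 /
                     (\<integral>x. (cmod (zpow x (prod_depth T u)))\<^sup>2 \<partial>sphere_measure)))"

end

(* The spherical Cauchy dual is a weighted shift whose weights depend only on depths: for fixed alpha
   the vectors S^alpha e_v (v in V) are orthogonal, and |S^alpha e_v|^2 = R(d_v + alpha) / R(d_v) with
   R(gamma) = gamma! (|gamma| + a - 1)! / ((|gamma| + d - 1)!)^2. This quotient splits as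
     int_0^1 s^|alpha| omega_l(s) ds   *   int |z^alpha|^2 |z^beta|^2 dsigma / int |z^beta|^2 dsigma
   with beta = d_v and l = |beta|. The first factor is a Beta integral, as omega_l is a multiple of
   s^(a + l - 1) (1 - s)^(d - 1 - a); the second one follows from the moments of sigma, computed by
   comparing a Gaussian integral on C^d in Cartesian and in polar coordinates. Hence the operator measure
   multiplying f(v) by the scalar measure attached to d_v represents the norm; it preserves the joint
   kernel because depth is constant on Chi_j(v), and acts as a scalar on each block L_{u,F} because
   depth is constant on sib_F(u). *)
theory Submission
  imports Defs "HOL-Probability.Probability"
begin

section \<open>Moments of the measures on the sphere and on the unit interval\<close>

text \<open>R comes from a one-step rule. Passing from a vertex of depth \<beta>, with n =
  |\<beta>|, to its children in direction j multiplies squared norms by ((n + a) / (n + d))^2 times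
  (\<beta>_j + 1) / (n + a): the first factor is the normalisation of the Cauchy dual, the second
  the squared norm of the original shift. Up to a constant, R is the function of multi-indices with
  these ratios, so the factors telescope along every path. Two obstacles shape the rest. Surface
  measure is available only as the image under \<open>sgn\<close> of the uniform measure on the
  ball; its moments are ball integrals of functions homogeneous of degree 0, and the Gaussian serves
  to extract them. Moreover adjoints, norms and \<open>quadratic_measure\<close> are given by
  definite descriptions, unordered sums and \<open>measure_of\<close>, which say something only once
  existence, convergence or additivity is known. Squared norms are therefore computed in
  \<open>ennreal\<close>, as integrals over counting measure, where interchanges are free, and
  finiteness is read off from the moments before returning to real numbers.\<close>

lemma measurable_vec_lambda:
  "vec_lambda \<in> (\<Pi>\<^sub>M i\<in>(UNIV :: 'n::finite set). (borel :: 'a::euclidean_space measure)) \<rightarrow>\<^sub>M (borel :: ('a ^ 'n) measure)"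
proof (subst borel_measurable_euclidean_space, intro ballI)
  fix b :: "'a ^ 'n" assume "b \<in> Basis"
  then obtain i u where b: "b = axis i u" "u \<in> Basis" by (auto simp: Basis_vec_def)
  show "(\<lambda>f. vec_lambda f \<bullet> b) \<in> borel_measurable (\<Pi>\<^sub>M i\<in>(UNIV :: 'n set). (borel :: 'a measure))"
    unfolding b inner_axis by (simp add: vec_lambda_beta) measurable
qed

lemma box_vec: "box l u = {x :: 'a::euclidean_space ^ 'n. \<forall>i. x $ i \<in> box (l $ i) (u $ i)}"
  by (auto simp: box_def Basis_vec_def inner_axis)

lemma prod_Basis_vec:
  fixes g :: "'a::euclidean_space ^ 'n \<Rightarrow> 'c::comm_monoid_mult"
  shows "(\<Prod>b\<in>Basis. g b) = (\<Prod>i\<in>UNIV. \<Prod>u\<in>Basis. g (axis i u))"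
proof -
  have eq: "(Basis :: ('a ^ 'n) set) = (\<lambda>(i, u). axis i u) ` (UNIV \<times> Basis)"
    by (auto simp: Basis_vec_def)
  have inj: "inj_on (\<lambda>(i, u). axis i u :: 'a ^ 'n) (UNIV \<times> Basis)"
    by (auto simp: inj_on_def axis_eq_axis)
  show ?thesis
    unfolding eq prod.reindex[OF inj] prod.cartesian_product
    by (intro prod.cong) auto
qed

text \<open>Lebesgue measure is determined by its values on boxes, and a box of vectors is a product
  of coordinate boxes. The purpose is Tonelli over the coordinates of C^d.\<close>

lemma lborel_vec:
  "(lborel :: ('a::euclidean_space ^ 'n) measure) = distr (\<Pi>\<^sub>M i\<in>UNIV. lborel) borel vec_lambda"
proof (rule lborel_eqI)
  interpret product_sigma_finite "\<lambda>_::'n. lborel :: 'a measure" by standard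
  have meas: "vec_lambda \<in> (\<Pi>\<^sub>M i\<in>(UNIV :: 'n set). (lborel :: 'a measure)) \<rightarrow>\<^sub>M (borel :: ('a ^ 'n) measure)"
    using measurable_vec_lambda by (simp cong: measurable_cong_sets sets_PiM_cong)
  fix l u :: "'a ^ 'n"
  assume le: "\<And>b. b \<in> Basis \<Longrightarrow> l \<bullet> b \<le> u \<bullet> b"
  have le': "l $ i \<bullet> b \<le> u $ i \<bullet> b" if "b \<in> Basis" for i b
    using le[of "axis i b"] that by (simp add: inner_axis)
  have "emeasure (distr (\<Pi>\<^sub>M i\<in>UNIV. lborel) borel vec_lambda) (box l u)
      = emeasure (\<Pi>\<^sub>M i\<in>(UNIV :: 'n set). (lborel :: 'a measure)) (\<Pi>\<^sub>E i\<in>UNIV. box (l $ i) (u $ i))"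
    by (subst emeasure_distr[OF meas]) (simp, rule arg_cong[where f = "emeasure _"], auto simp: box_vec space_PiM)
  also have "\<dots> = (\<Prod>i\<in>UNIV. emeasure lborel (box (l $ i) (u $ i)))"
    by (subst emeasure_PiM) auto
  also have "\<dots> = (\<Prod>i\<in>UNIV. ennreal (\<Prod>b\<in>Basis. (u $ i - l $ i) \<bullet> b))"
    by (intro prod.cong refl emeasure_lborel_box le')
  also have "\<dots> = ennreal (\<Prod>b\<in>Basis. (u - l) \<bullet> b)"
    by (subst prod_ennreal) (auto intro!: prod_nonneg simp: le' prod_Basis_vec inner_axis inner_diff_left)
  finally show "emeasure (distr (\<Pi>\<^sub>M i\<in>UNIV. lborel) borel vec_lambda) (box l u)
      = ennreal (\<Prod>b\<in>Basis. (u - l) \<bullet> b)" .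
qed simp

lemma borel_measurable_vec_nth[measurable]:
  "(\<lambda>z :: 'a::euclidean_space ^ 'n. z $ i) \<in> borel_measurable borel"
  by (intro borel_measurable_continuous_onI continuous_intros)

lemma nn_integral_lborel_vec_prod:
  fixes g :: "'n::finite \<Rightarrow> 'a::euclidean_space \<Rightarrow> ennreal"
  assumes [measurable]: "\<And>i. g i \<in> borel_measurable borel"
  shows "(\<integral>\<^sup>+z. (\<Prod>i\<in>UNIV. g i (z $ i)) \<partial>(lborel :: ('a ^ 'n) measure)) = (\<Prod>i\<in>UNIV. \<integral>\<^sup>+x. g i x \<partial>lborel)"
proof -
  interpret product_sigma_finite "\<lambda>_::'n. lborel :: 'a measure" by standard
  have meas: "vec_lambda \<in> (\<Pi>\<^sub>M i\<in>(UNIV :: 'n set). (lborel :: 'a measure)) \<rightarrow>\<^sub>M (borel :: ('a ^ 'n) measure)"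
    using measurable_vec_lambda by (simp cong: measurable_cong_sets sets_PiM_cong)
  show ?thesis
    by (subst lborel_vec, subst nn_integral_distr[OF meas])
       (auto simp: product_nn_integral_prod)
qed

section \<open>Integration of homogeneous functions in polar coordinates\<close>

text \<open>Dilating by \<open>r\<close> leaves a function of degree 0 unchanged, so only the
  Jacobian survives.\<close>

lemma nn_integral_ball_homogeneous:
  fixes h :: "'a::euclidean_space \<Rightarrow> ennreal"
  assumes [measurable]: "h \<in> borel_measurable borel"
    and hom: "\<And>c x. c > 0 \<Longrightarrow> h (c *\<^sub>R x) = h x" and r: "r > 0"
  shows "(\<integral>\<^sup>+x\<in>ball 0 r. h x \<partial>lborel) = ennreal (r ^ DIM('a)) * (\<integral>\<^sup>+x\<in>ball 0 1. h x \<partial>lborel)"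
proof -
  have [measurable]: "(\<lambda>x :: 'a. r *\<^sub>R x) \<in> borel_measurable borel" by measurable
  have [measurable]: "ball (0::'a) q \<in> sets borel" for q by simp
  have "(\<integral>\<^sup>+x\<in>ball 0 r. h x \<partial>lborel)
      = (\<integral>\<^sup>+x. h x * indicator (ball 0 r) x \<partial>density (distr lborel borel (\<lambda>x. 0 + r *\<^sub>R x)) (\<lambda>_. ennreal (\<bar>r\<bar> ^ DIM('a))))"
    using r by (subst lborel_affine[of r 0]) auto
  also have "\<dots> = (\<integral>\<^sup>+x. ennreal (r ^ DIM('a)) * (h (r *\<^sub>R x) * indicator (ball 0 r) (r *\<^sub>R x)) \<partial>lborel)"
    using r by (simp add: nn_integral_density nn_integral_distr)
  also have "\<dots> = (\<integral>\<^sup>+x. ennreal (r ^ DIM('a)) * (h x * indicator (ball 0 1) x) \<partial>lborel)"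
    using r by (intro nn_integral_cong) (auto simp: hom indicator_def)
  finally show ?thesis by (simp add: nn_integral_cmult)
qed

lemma nn_integral_power_Icc:
  assumes "0 \<le> (r::real)" "m > 0"
  shows "(\<integral>\<^sup>+s. ennreal (m * s ^ (m - 1)) * indicator {0..r} s \<partial>lborel) = ennreal (r ^ m)"
  using assms by (subst nn_integral_FTC_Icc[where F = "\<lambda>s. s ^ m"])
    (auto intro!: derivative_eq_intros simp: has_real_derivative_iff_has_vector_derivative[symmetric])

text \<open>Integration in polar coordinates, in terms of the squared radius; comparing distribution
  functions avoids constructing a surface measure.\<close>

lemma nn_integral_homogeneous_radial:
  fixes h :: "'a::euclidean_space \<Rightarrow> ennreal" and \<phi> :: "real \<Rightarrow> ennreal"
  assumes [measurable]: "h \<in> borel_measurable borel" "\<phi> \<in> borel_measurable borel"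
    and hom: "\<And>c x. c > 0 \<Longrightarrow> h (c *\<^sub>R x) = h x"
    and m: "DIM('a) = 2 * m"
    and fin: "(\<integral>\<^sup>+x\<in>ball 0 1. h x \<partial>lborel) < \<infinity>"
  shows "(\<integral>\<^sup>+x. h x * \<phi> ((norm x)\<^sup>2) \<partial>lborel)
       = (\<integral>\<^sup>+x\<in>ball 0 1. h x \<partial>lborel) * (\<integral>\<^sup>+s\<in>{0..}. ennreal (m * s ^ (m - 1)) * \<phi> s \<partial>lborel)"
proof -
  define H where "H = (\<integral>\<^sup>+x\<in>ball 0 1. h x \<partial>lborel)"
  have m0: "m > 0" using m DIM_positive[where 'a = 'a] by linarith
  \<comment> \<open>\<open>H * s ^ m\<close> is the \<open>h\<close>-mass of the ball of squared
    radius \<open>s\<close>, because the real dimension is \<open>2 * m\<close>; \<open>w\<close> is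
    its derivative in \<open>s\<close>.\<close>
  define w where "w = (\<lambda>s::real. H * (ennreal (m * s ^ (m - 1)) * indicator {0..} s))"
  have [measurable]: "w \<in> borel_measurable borel" unfolding w_def by measurable
  \<comment> \<open>The sign reverses the order: equality of measures is tested on rays
    \<open>{y<..}\<close> of finite mass, and it is the balls, not their complements, whose mass is
    known to be finite.\<close>
  define M where "M = distr (density lborel h) borel (\<lambda>x. - ((norm x)\<^sup>2))"
  define N where "N = distr (density lborel w) borel uminus"
  have M_eq: "emeasure M {y<..} = (if y < 0 then ennreal ((- y) ^ m) * H else 0)" for y
  proof -
    have "emeasure M {y<..} = (\<integral>\<^sup>+x. h x * indicator {x. (norm x)\<^sup>2 < - y} x \<partial>lborel)"
    proof -
      have "(\<lambda>x::'a. - ((norm x)\<^sup>2)) -` {y<..} = {x. (norm x)\<^sup>2 < - y}" by auto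
      moreover have "{x::'a. (norm x)\<^sup>2 < - y} \<in> sets borel" by measurable
      ultimately show ?thesis
        unfolding M_def by (subst emeasure_distr) (auto simp: emeasure_density)
    qed
    also have "{x :: 'a. (norm x)\<^sup>2 < - y} = (if y < 0 then ball 0 (sqrt (- y)) else {})"
      by (auto simp: real_less_rsqrt not_less sqrt_le_D intro: order_trans[OF _ zero_le_power2])
         (smt (verit) real_sqrt_less_mono norm_ge_zero real_sqrt_abs real_sqrt_pow2 power_strict_mono pos2)+
    also have "(\<integral>\<^sup>+x. h x * indicator \<dots> x \<partial>lborel) = (if y < 0 then ennreal ((- y) ^ m) * H else 0)"
      using nn_integral_ball_homogeneous[OF assms(1) hom, of "sqrt (- y)"]
      by (auto simp: H_def m power_mult)
    finally show ?thesis .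
  qed
  have N_eq: "emeasure N {y<..} = (if y < 0 then ennreal ((- y) ^ m) * H else 0)" for y
  proof -
    have "emeasure N {y<..} = (\<integral>\<^sup>+s. w s * indicator {..<- y} s \<partial>lborel)"
    proof -
      have "uminus -` {y<..} = {..<- y}" by auto
      then show ?thesis
        unfolding N_def by (subst emeasure_distr) (auto simp: emeasure_density)
    qed
    also have "\<dots> = (\<integral>\<^sup>+s. H * (ennreal (m * s ^ (m - 1)) * indicator {0..- y} s) \<partial>lborel)"
      using AE_lborel_singleton[of "-y"]
      by (intro nn_integral_cong_AE) (auto simp: w_def split: split_indicator elim!: eventually_mono)
    also have "\<dots> = H * (\<integral>\<^sup>+s. ennreal (m * s ^ (m - 1)) * indicator {0..- y} s \<partial>lborel)"
      by (intro nn_integral_cmult) auto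
    also have "\<dots> = (if y < 0 then ennreal ((- y) ^ m) * H else 0)"
    proof (cases "y < 0")
      case True
      then show ?thesis using nn_integral_power_Icc[of "-y" m] m0 by (simp add: mult.commute)
    next
      case False
      \<comment> \<open>For \<open>y \<ge> 0\<close> the interval is empty or the single point 0,
        where the density does not vanish if \<open>m = 1\<close>.\<close>
      have "AE s in lborel. ennreal (m * s ^ (m - 1)) * indicator {0..- y} s = 0"
        using AE_lborel_singleton[of 0] by eventually_elim (use False in \<open>auto split: split_indicator\<close>)
      then have "(\<integral>\<^sup>+s. ennreal (m * s ^ (m - 1)) * indicator {0..- y} s \<partial>lborel) = 0"
        by (subst nn_integral_0_iff_AE) auto
      with False show ?thesis by simp
    qed
    finally show ?thesis .
  qed
  have "M = N"
    using fin by (intro measure_eqI_lessThan)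
      (auto simp: M_eq N_eq H_def[symmetric] ennreal_mult_less_top, auto simp: M_def N_def)
  then have "(\<integral>\<^sup>+y. \<phi> (- y) \<partial>M) = (\<integral>\<^sup>+y. \<phi> (- y) \<partial>N)" by simp
  moreover have "(\<integral>\<^sup>+y. \<phi> (- y) \<partial>M) = (\<integral>\<^sup>+x. h x * \<phi> ((norm x)\<^sup>2) \<partial>lborel)"
    unfolding M_def by (simp add: nn_integral_distr nn_integral_density)
  moreover have "(\<integral>\<^sup>+y. \<phi> (- y) \<partial>N) = H * (\<integral>\<^sup>+s\<in>{0..}. ennreal (m * s ^ (m - 1)) * \<phi> s \<partial>lborel)"
    unfolding N_def by (simp add: nn_integral_distr nn_integral_density w_def mult_ac flip: nn_integral_cmult)
  ultimately show ?thesis by (simp add: H_def)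
qed

section \<open>Gaussian integrals and the moments of the sphere\<close>

lemma nn_integral_power_exp:
  "(\<integral>\<^sup>+s\<in>{0..}. ennreal (s ^ k * exp (- s)) \<partial>lborel) = ennreal (fact k)"
  using nn_intergal_power_times_exp_Ici[of k] by (simp add: ennreal_indicator ennreal_mult' flip: ennreal_indicator)

text \<open>The polar formula in real dimension 2, so \<open>m = 1\<close>: the area of the disc
  times a Gamma integral.\<close>

lemma nn_integral_gaussian_complex:
  "(\<integral>\<^sup>+z. ennreal ((cmod z)\<^sup>2 ^ k * exp (- (cmod z)\<^sup>2)) \<partial>lborel) = ennreal (pi * fact k)"
proof -
  have ball: "(\<integral>\<^sup>+x\<in>ball (0::complex) 1. 1 \<partial>lborel) = ennreal pi"
    by (simp add: emeasure_ball unit_ball_vol_2)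
  show ?thesis
    using nn_integral_homogeneous_radial[of "\<lambda>_::complex. 1" "\<lambda>s. ennreal (s ^ k * exp (- s))" 1]
    unfolding ball by (simp add: nn_integral_power_exp ennreal_mult')
qed

abbreviation multi_fact :: "('d::finite \<Rightarrow> nat) \<Rightarrow> real" where
  "multi_fact \<gamma> \<equiv> \<Prod>j\<in>UNIV. fact (\<gamma> j)"

lemma borel_measurable_zpow[measurable]: "(\<lambda>z. zpow z \<gamma>) \<in> borel_measurable borel"
  unfolding zpow_def by measurable

lemma cmod_zpow_power2: "(cmod (zpow z \<gamma>))\<^sup>2 = (\<Prod>j\<in>UNIV. (cmod (z $ j))\<^sup>2 ^ \<gamma> j)"
  by (simp add: zpow_def norm_power prod_power_distrib mult.commute flip: prod_norm power_mult)

lemma cmod_zpow_le: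
  assumes "norm z \<le> 1"
  shows "cmod (zpow z \<gamma>) \<le> 1"
proof -
  have "cmod (z $ j) \<le> 1" for j
    using Finite_Cartesian_Product.norm_nth_le[of z j] assms by simp
  then show ?thesis
    unfolding zpow_def prod_norm[symmetric] by (intro prod_le_1) (auto simp: norm_power intro!: power_le_one)
qed

lemma multi_abs_add: "multi_abs (\<lambda>j. \<alpha> j + \<beta> j) = multi_abs \<alpha> + multi_abs \<beta>"
  by (simp add: multi_abs_def sum.distrib)

lemma zpow_add: "zpow z (\<lambda>j. \<alpha> j + \<beta> j) = zpow z \<alpha> * zpow z \<beta>"
  by (simp add: zpow_def power_add prod.distrib)

lemma zpow_scaleR: "zpow (c *\<^sub>R z) \<gamma> = of_real c ^ multi_abs \<gamma> * zpow z \<gamma>"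
  by (simp add: zpow_def multi_abs_def power_sum prod.distrib power_mult_distrib
      scaleR_conv_of_real[where 'a = complex])

lemma norm_vec_power2: "(norm z)\<^sup>2 = (\<Sum>j\<in>UNIV. (norm (z $ j))\<^sup>2)"
  by (simp add: norm_vec_def L2_set_def sum_nonneg)

lemma DIM_complex_vec: "DIM(complex ^ 'd) = 2 * CARD('d)" by simp

text \<open>The Cartesian side of the comparison: the monomial and the Gaussian both factor over the
  coordinates.\<close>

lemma nn_integral_gaussian_monomial:
  "(\<integral>\<^sup>+z. ennreal ((cmod (zpow z \<gamma>))\<^sup>2 * exp (- (norm z)\<^sup>2)) \<partial>(lborel :: (complex ^ 'd::finite) measure))
     = ennreal (pi ^ CARD('d) * multi_fact \<gamma>)"
proof -
  have "(\<integral>\<^sup>+z. ennreal ((cmod (zpow z \<gamma>))\<^sup>2 * exp (- (norm z)\<^sup>2)) \<partial>(lborel :: (complex ^ 'd) measure))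
      = (\<integral>\<^sup>+z. (\<Prod>j\<in>UNIV. ennreal ((cmod (z $ j))\<^sup>2 ^ \<gamma> j * exp (- (cmod (z $ j))\<^sup>2))) \<partial>(lborel :: (complex ^ 'd) measure))"
    by (intro nn_integral_cong, subst prod_ennreal)
       (auto simp: cmod_zpow_power2 norm_vec_power2 exp_sum prod.distrib simp flip: sum_negf)
  also have "\<dots> = (\<Prod>j\<in>(UNIV :: 'd set). ennreal (pi * fact (\<gamma> j)))"
    by (subst nn_integral_lborel_vec_prod) (auto simp: nn_integral_gaussian_complex)
  also have "\<dots> = ennreal (pi ^ CARD('d) * multi_fact \<gamma>)"
    by (subst prod_ennreal) (auto simp: prod.distrib)
  finally show ?thesis .
qed

text \<open>The polar side. Writing z = |z| sgn z splits off |z|^(2n) with n = |\<gamma>|, so the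
  Gaussian integral of the monomial is the wanted ball integral times d (n + d - 1)!, and division
  gives the value.\<close>

lemma nn_integral_sgn_monomial:
  "(\<integral>\<^sup>+z\<in>ball 0 1. ennreal ((cmod (zpow (sgn z) \<gamma>))\<^sup>2) \<partial>(lborel :: (complex ^ 'd::finite) measure))
     = ennreal (pi ^ CARD('d) * multi_fact \<gamma> / (CARD('d) * fact (multi_abs \<gamma> + CARD('d) - 1)))"
proof -
  let ?n = "multi_abs \<gamma>" and ?d = "CARD('d)"
  let ?h = "\<lambda>z :: complex ^ 'd. ennreal ((cmod (zpow (sgn z) \<gamma>))\<^sup>2)"
  let ?H = "\<integral>\<^sup>+z\<in>ball 0 1. ?h z \<partial>lborel"
  have d: "?d > 0" by simp
  have cmod_le: "cmod (zpow (sgn z) \<gamma>) \<le> 1" for z :: "complex ^ 'd"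
    by (intro cmod_zpow_le) (simp add: norm_sgn)
  have fin: "?H < \<infinity>"
  proof -
    have "?H \<le> (\<integral>\<^sup>+z. indicator (ball (0 :: complex ^ 'd) 1) z \<partial>lborel)"
      by (intro nn_integral_mono) (auto split: split_indicator simp: power_le_one cmod_le)
    also have "\<dots> < \<infinity>" using emeasure_lborel_ball_finite[of "0 :: complex ^ 'd" 1] by simp
    finally show ?thesis .
  qed
  have "ennreal (pi ^ ?d * multi_fact \<gamma>)
      = (\<integral>\<^sup>+z. ?h z * ennreal ((norm z)\<^sup>2 ^ ?n * exp (- (norm z)\<^sup>2)) \<partial>lborel)"
    unfolding nn_integral_gaussian_monomial[symmetric]
  proof (intro nn_integral_cong)
    fix z :: "complex ^ 'd"
    have "(cmod (zpow z \<gamma>))\<^sup>2 = (cmod (zpow (sgn z) \<gamma>))\<^sup>2 * (norm z)\<^sup>2 ^ ?n"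
    proof -
      have "norm z *\<^sub>R sgn z = z" by (cases "z = 0") (simp_all add: sgn_div_norm)
      then have "zpow z \<gamma> = of_real (norm z) ^ ?n * zpow (sgn z) \<gamma>"
        by (metis zpow_scaleR)
      then show ?thesis
        by (simp add: norm_mult norm_power power_mult_distrib mult.commute flip: power_mult)
    qed
    then show "ennreal ((cmod (zpow z \<gamma>))\<^sup>2 * exp (- (norm z)\<^sup>2))
        = ?h z * ennreal ((norm z)\<^sup>2 ^ ?n * exp (- (norm z)\<^sup>2))"
      by (simp flip: ennreal_mult)
  qed
  also have "\<dots> = ?H * (\<integral>\<^sup>+s\<in>{0..}. ennreal (?d * s ^ (?d - 1)) * ennreal (s ^ ?n * exp (- s)) \<partial>lborel)"
    by (rule nn_integral_homogeneous_radial[OF _ _ _ DIM_complex_vec fin])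
       (auto simp: sgn_scaleR)
  also have "(\<integral>\<^sup>+s\<in>{0..}. ennreal (?d * s ^ (?d - 1)) * ennreal (s ^ ?n * exp (- s)) \<partial>lborel)
      = (\<integral>\<^sup>+s. ennreal ?d * (ennreal (s ^ (?n + ?d - 1) * exp (- s)) * indicator {0..} s) \<partial>lborel)"
  proof -
    have e: "?n + ?d - 1 = ?n + (?d - 1)" using d by linarith
    show ?thesis
      unfolding e power_add
      by (intro nn_integral_cong) (auto split: split_indicator simp: mult_ac simp flip: ennreal_mult)
  qed
  also have "\<dots> = ennreal ?d * ennreal (fact (?n + ?d - 1))"
    by (subst nn_integral_cmult) (auto simp: nn_integral_power_exp)
  finally have eq: "ennreal (pi ^ ?d * multi_fact \<gamma>) = ?H * ennreal (?d * fact (?n + ?d - 1))"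
    by (simp add: ennreal_mult')
  obtain H where H: "?H = ennreal H" "H \<ge> 0" using fin by (cases ?H) auto
  have "pi ^ ?d * multi_fact \<gamma> = H * (?d * fact (?n + ?d - 1))"
    using eq H by (simp flip: ennreal_mult) (simp add: ennreal_inj prod_nonneg)
  then show ?thesis unfolding H(1) using d by (simp add: field_simps)
qed

lemma sphere_moment:
  "(\<integral>\<^sup>+z. ennreal ((cmod (zpow z \<gamma>))\<^sup>2) \<partial>(sphere_measure :: (complex ^ 'd::finite) measure))
     = ennreal (fact (CARD('d) - 1) * multi_fact \<gamma> / fact (multi_abs \<gamma> + CARD('d) - 1))"
proof -
  let ?B = "ball (0 :: complex ^ 'd) 1"
  \<comment> \<open>Exponent 0 yields the volume of the ball in the same form, so that the powers of
    pi and the factor d cancel in the quotient.\<close>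
  have vol: "emeasure lborel ?B = ennreal (pi ^ CARD('d) / (CARD('d) * fact (CARD('d) - 1)))"
    using nn_integral_sgn_monomial[where \<gamma> = "\<lambda>_::'d. 0"] by (simp add: zpow_def multi_abs_def)
  have "(\<integral>\<^sup>+z. ennreal ((cmod (zpow z \<gamma>))\<^sup>2) \<partial>sphere_measure)
      = (\<integral>\<^sup>+z\<in>?B. ennreal ((cmod (zpow (sgn z) \<gamma>))\<^sup>2) \<partial>lborel) / emeasure lborel ?B"
    unfolding sphere_measure_def
    by (simp add: nn_integral_distr nn_integral_uniform_measure)
  then show ?thesis
    unfolding vol nn_integral_sgn_monomial by (simp add: divide_ennreal prod_nonneg)
qed

section \<open>The radial density and its Beta moments\<close>

text \<open>The k factors with j < k are negative and give the sign; the others give (n - k)!. Such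
  denominators turn the sum in \<open>omega\<close> into a binomial expansion.\<close>

lemma prod_diff_atMost:
  assumes "k \<le> n"
  shows "(\<Prod>j\<in>{..n} - {k}. real j - real k) = (-1) ^ k * fact k * fact (n - k)"
proof -
  have eq: "{..n} - {k} = {..<k} \<union> {k<..n}" using assms by auto
  have "(\<Prod>j\<in>{..n} - {k}. real j - real k)
      = (\<Prod>j\<in>{..<k}. real j - real k) * (\<Prod>j\<in>{k<..n}. real j - real k)"
    unfolding eq by (rule prod.union_disjoint) auto
  also have "(\<Prod>j\<in>{..<k}. real j - real k) = (\<Prod>i\<in>{1..k}. - real i)"
    by (rule prod.reindex_bij_witness[of _ "\<lambda>i. k - i" "\<lambda>j. k - j"]) auto
  also have "\<dots> = (-1) ^ k * fact k"
    by (simp add: prod_uminus fact_prod)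
  also have "(\<Prod>j\<in>{k<..n}. real j - real k) = (\<Prod>i\<in>{1..n-k}. real i)"
    by (rule prod.reindex_bij_witness[of _ "\<lambda>i. i + k" "\<lambda>j. j - k"]) auto
  finally show ?thesis by (simp add: fact_prod)
qed

text \<open>With i = a + k the sum becomes s^(a + l - 1) / n! times the binomial expansion of (1 -
  s)^n, where n = d - 1 - a. The closed form also exhibits the nonnegativity on [0,1], which the
  alternating signs hide.\<close>

lemma omega_eq:
  assumes "0 < a" "a < d"
  shows "omega d a l s = fact (l + d - 1) / fact (l + a - 1) / fact (d - 1 - a) * (s ^ (a + l - 1) * (1 - s) ^ (d - 1 - a))"
proof -
  define n where "n = d - 1 - a"
  have d: "d - 1 = a + n" using assms by (simp add: n_def)
  have "(\<Prod>k\<in>{a..d-1}. real l + real k) = fact (l + d - 1) / fact (l + a - 1)"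
  proof -
    have "fact (l + a - 1) * (\<Prod>k\<in>{a..a+n'}. real l + real k) = fact (l + a + n')" for n'
    proof (induction n')
      case 0
      then show ?case using assms by (simp add: fact_num_eq_if[of "l + a"])
    next
      case (Suc n')
      then show ?case by (simp add: algebra_simps)
    qed
    from this[of n] show ?thesis using assms d by (simp add: field_simps n_def)
  qed
  moreover have "(\<Sum>i\<in>{a..d-1}. s ^ (i + l - 1) / (\<Prod>j\<in>{a..d-1} - {i}. real j - real i))
      = s ^ (a + l - 1) * (1 - s) ^ n / fact n"
  proof -
    have "(\<Sum>i\<in>{a..d-1}. s ^ (i + l - 1) / (\<Prod>j\<in>{a..d-1} - {i}. real j - real i))
        = (\<Sum>k\<in>{..n}. s ^ (k + a + l - 1) / (\<Prod>j\<in>{a..d-1} - {k + a}. real j - real (k + a)))"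
      by (rule sum.reindex_bij_witness[of _ "\<lambda>k. k + a" "\<lambda>i. i - a"]) (use d in auto)
    also have "\<dots> = (\<Sum>k\<in>{..n}. s ^ (a + l - 1) / fact n * (of_nat (n choose k) * (- s) ^ k * 1 ^ (n - k)))"
    proof (intro sum.cong refl)
      fix k assume k: "k \<in> {..n}"
      have "(\<Prod>j\<in>{a..d-1} - {k + a}. real j - real (k + a)) = (\<Prod>j\<in>{..n} - {k}. real j - real k)"
        by (rule prod.reindex_bij_witness[of _ "\<lambda>k. k + a" "\<lambda>i. i - a"]) (use d in auto)
      also have "\<dots> = (-1) ^ k * fact k * fact (n - k)" using k by (intro prod_diff_atMost) auto
      finally have prod: "(\<Prod>j\<in>{a..d-1} - {k + a}. real j - real (k + a)) = (-1) ^ k * fact k * fact (n - k)" .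
      have "s ^ (k + a + l - 1) / (\<Prod>j\<in>{a..d-1} - {k + a}. real j - real (k + a))
          = s ^ (k + (a + l - 1)) / ((-1) ^ k * fact k * fact (n - k))"
      proof -
        have "k + a + l - 1 = k + (a + l - 1)" using assms by simp
        then show ?thesis by (simp only: prod)
      qed
      also have "\<dots> = s ^ (a + l - 1) / fact n * (of_nat (n choose k) * (- s) ^ k * 1 ^ (n - k))"
        using k by (simp add: binomial_fact power_add power_minus[of s] minus_one_power_iff)
      finally show "s ^ (k + a + l - 1) / (\<Prod>j\<in>{a..d-1} - {k + a}. real j - real (k + a)) = \<dots>" .
    qed
    also have "\<dots> = s ^ (a + l - 1) / fact n * (- s + 1) ^ n"
      by (simp only: binomial_ring sum_distrib_left)
    finally show ?thesis by simp
  qed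
  ultimately show ?thesis by (simp add: omega_def n_def)
qed

lemma omega_nonneg: "0 < a \<Longrightarrow> a < d \<Longrightarrow> s \<in> {0..1} \<Longrightarrow> 0 \<le> omega d a l s"
  by (simp add: omega_eq)

lemma borel_measurable_omega[measurable]: "omega d a l \<in> borel_measurable borel"
  unfolding omega_def by measurable

lemma nn_integral_Beta_fact:
  "(\<integral>\<^sup>+s\<in>{0..1}. ennreal (s ^ p * (1 - s) ^ q) \<partial>lborel) = ennreal (fact p * fact q / fact (p + q + 1))"
proof -
  have "((\<lambda>t. t powr (real (p + 1) - 1) * (1 - t) powr (real (q + 1) - 1)) has_integral Beta (real (p + 1)) (real (q + 1))) {0..1}"
    by (rule has_integral_Beta_real) auto
  \<comment> \<open>The integrands may differ at the endpoints, because \<open>0 powr 0\<close> is 0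
    whereas \<open>0 ^ 0\<close> is 1.\<close>
  then have "((\<lambda>t::real. t ^ p * (1 - t) ^ q) has_integral Beta (real (p + 1)) (real (q + 1))) {0..1}"
    by (rule has_integral_spike_finite[of "{0, 1}", rotated 2]) (auto simp: powr_realpow)
  moreover have "Beta (real (p + 1)) (real (q + 1)) = fact p * fact q / fact (p + q + 1)"
    using Gamma_fact[of p, where 'a = real] Gamma_fact[of q, where 'a = real] Gamma_fact[of "p + q + 1", where 'a = real]
    by (simp add: Beta_def add_ac)
  ultimately show ?thesis
    by (intro nn_integral_has_integral_lebesgue') auto
qed

text \<open>The measures of the theorem depend on the vertex only through its depth \<open>\<beta>\<close>.\<close>

definition radial :: "nat \<Rightarrow> nat \<Rightarrow> nat \<Rightarrow> real measure" where
  "radial d a l = density unit_lebesgue (\<lambda>s. ennreal (omega d a l s))"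

definition spherical :: "('d::finite \<Rightarrow> nat) \<Rightarrow> (complex ^ 'd) measure" where
  "spherical \<beta> = density sphere_measure
     (\<lambda>z. ennreal ((cmod (zpow z \<beta>))\<^sup>2 / (\<integral>x. (cmod (zpow x \<beta>))\<^sup>2 \<partial>sphere_measure)))"

lemma sets_radial[simp, measurable_cong]: "sets (radial d a l) = sets borel"
  by (simp add: radial_def unit_lebesgue_def)

lemma sets_sphere_measure[simp, measurable_cong]: "sets sphere_measure = sets borel"
  by (simp add: sphere_measure_def)

lemma sets_spherical[simp, measurable_cong]: "sets (spherical \<beta>) = sets borel"
  by (simp add: spherical_def)

lemma space_radial[simp]: "space (radial d a l) = UNIV"
  by (simp add: radial_def unit_lebesgue_def)

lemma space_spherical[simp]: "space (spherical \<beta>) = UNIV"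
  by (simp add: spherical_def sphere_measure_def)

lemma nn_integral_radial:
  assumes "0 < a" "a < d" and [measurable]: "g \<in> borel_measurable borel"
  shows "(\<integral>\<^sup>+s. g s \<partial>radial d a l) = (\<integral>\<^sup>+s\<in>{0..1}. ennreal (omega d a l s) * g s \<partial>lborel)"
proof -
  have "(\<integral>\<^sup>+s. g s \<partial>radial d a l)
      = (\<integral>\<^sup>+s. indicator {0..1} s * (ennreal (omega d a l s) * g s) \<partial>lborel)"
    unfolding radial_def unit_lebesgue_def by (simp add: nn_integral_density)
  then show ?thesis by (simp add: mult_ac)
qed

text \<open>A Beta integral in which (d - 1 - a)! cancels. For \<open>k = 0\<close> the value is 1,
  which explains the prefactor of \<open>omega\<close>.\<close>

lemma radial_moment:
  assumes "0 < a" "a < d"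
  shows "(\<integral>\<^sup>+s. ennreal (s ^ k) \<partial>radial d a l)
     = ennreal (fact (l + d - 1) / fact (l + a - 1) * fact (k + l + a - 1) / fact (k + l + d - 1))"
proof -
  let ?c = "fact (l + d - 1) / fact (l + a - 1) / fact (d - 1 - a) :: real"
  have "(\<integral>\<^sup>+s. ennreal (s ^ k) \<partial>radial d a l)
      = (\<integral>\<^sup>+s. ennreal ?c * (ennreal (s ^ (k + l + a - 1) * (1 - s) ^ (d - 1 - a)) * indicator {0..1} s) \<partial>lborel)"
    unfolding nn_integral_radial[OF assms, of "\<lambda>s. ennreal (s ^ k)", simplified]
  proof (intro nn_integral_cong)
    fix s :: real
    have e: "k + l + a - 1 = k + (a + l - 1)" using assms by simp
    show "ennreal (omega d a l s) * ennreal (s ^ k) * indicator {0..1} s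
      = ennreal ?c * (ennreal (s ^ (k + l + a - 1) * (1 - s) ^ (d - 1 - a)) * indicator {0..1} s)"
      unfolding omega_eq[OF assms] e power_add
      by (auto split: split_indicator simp: mult_ac simp flip: ennreal_mult)
  qed
  also have "\<dots> = ennreal ?c * ennreal (fact (k + l + a - 1) * fact (d - 1 - a) / fact (k + l + a - 1 + (d - 1 - a) + 1))"
    by (subst nn_integral_cmult) (auto simp: nn_integral_Beta_fact)
  also have "k + l + a - 1 + (d - 1 - a) + 1 = k + l + d - 1" using assms by simp
  finally show ?thesis by (simp flip: ennreal_mult)
qed

lemma prob_space_radial:
  assumes "0 < a" "a < d"
  shows "prob_space (radial d a l)"
  using radial_moment[OF assms, where k = 0 and l = l] by (intro prob_spaceI) simp

lemma sphere_L2: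
  "(\<integral>z. (cmod (zpow z \<beta>))\<^sup>2 \<partial>(sphere_measure :: (complex ^ 'd::finite) measure))
    = fact (CARD('d) - 1) * multi_fact \<beta> / fact (multi_abs \<beta> + CARD('d) - 1)"
  by (subst integral_eq_nn_integral) (auto simp: sphere_moment prod_nonneg)

lemma nn_integral_spherical:
  assumes [measurable]: "g \<in> borel_measurable borel"
  shows "(\<integral>\<^sup>+z. g z \<partial>spherical \<beta>)
    = (\<integral>\<^sup>+z. ennreal ((cmod (zpow z \<beta>))\<^sup>2 / (\<integral>x. (cmod (zpow x \<beta>))\<^sup>2 \<partial>sphere_measure)) * g z \<partial>sphere_measure)"
  unfolding spherical_def by (rule nn_integral_density) auto

text \<open>The product of |z^\<alpha>|^2 and |z^\<beta>|^2 again comes from a monomial, so the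
  integral is a quotient of two sphere moments.\<close>

lemma spherical_moment:
  fixes \<alpha> \<beta> :: "'d::finite \<Rightarrow> nat"
  shows "(\<integral>\<^sup>+z. ennreal ((cmod (zpow z \<alpha>))\<^sup>2) \<partial>spherical \<beta>)
    = ennreal (multi_fact (\<lambda>j. \<alpha> j + \<beta> j) / multi_fact \<beta> * fact (multi_abs \<beta> + CARD('d) - 1)
        / fact (multi_abs \<alpha> + multi_abs \<beta> + CARD('d) - 1))"
proof -
  define c :: real where "c = fact (CARD('d) - 1) * multi_fact \<beta> / fact (multi_abs \<beta> + CARD('d) - 1)"
  have c: "c > 0" by (simp add: c_def prod_pos)
  have "(\<integral>\<^sup>+z. ennreal ((cmod (zpow z \<alpha>))\<^sup>2) \<partial>spherical \<beta>)
      = (\<integral>\<^sup>+z. ennreal (1 / c) * ennreal ((cmod (zpow z (\<lambda>j. \<alpha> j + \<beta> j)))\<^sup>2) \<partial>sphere_measure)"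
    unfolding nn_integral_spherical[of "\<lambda>z. ennreal ((cmod (zpow z \<alpha>))\<^sup>2)", simplified] sphere_L2 c_def[symmetric]
    using c by (intro nn_integral_cong) (simp add: zpow_add norm_mult power_mult_distrib mult.commute flip: ennreal_mult)
  also have "\<dots> = ennreal (1 / c) * ennreal (fact (CARD('d) - 1) * multi_fact (\<lambda>j. \<alpha> j + \<beta> j) / fact (multi_abs (\<lambda>j. \<alpha> j + \<beta> j) + CARD('d) - 1))"
    by (subst nn_integral_cmult) (auto simp: sphere_moment)
  finally show ?thesis
    using c unfolding multi_abs_add by (simp add: c_def ennreal_mult'[symmetric] prod_nonneg)
qed

lemma prob_space_spherical: "prob_space (spherical \<beta>)"
proof -
  have "(\<Prod>j\<in>UNIV. fact (\<beta> j) :: real) \<noteq> 0" by simp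
  then show ?thesis
    using spherical_moment[where \<alpha> = "\<lambda>_. 0" and \<beta> = \<beta>]
    by (intro prob_spaceI) (simp add: zpow_def multi_abs_def)
qed

lemma AE_radial:
  assumes "0 < a" "a < d"
  shows "AE s in radial d a l. s \<in> {0..1}"
  unfolding radial_def unit_lebesgue_def by (subst AE_density; (subst AE_density)?) (auto simp: indicator_def)

lemma AE_spherical: "AE z in spherical \<beta>. z \<in> sphere 0 1"
proof -
  have "AE z in uniform_measure lborel (ball (0 :: complex ^ 'd) 1). sgn z \<in> sphere 0 1"
    using AE_lborel_singleton[of 0]
    by (intro AE_uniform_measureI) (auto simp: norm_sgn elim!: eventually_mono)
  then have "AE z in (sphere_measure :: (complex ^ 'd) measure). z \<in> sphere 0 1"
    unfolding sphere_measure_def by (subst AE_distr_iff) auto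
  then show ?thesis
    unfolding spherical_def by (subst AE_density) (auto elim!: eventually_mono)
qed

section \<open>The product measure attached to a depth\<close>

definition block_measure :: "nat \<Rightarrow> ('d::finite \<Rightarrow> nat) \<Rightarrow> (real \<times> (complex ^ 'd)) measure" where
  "block_measure a \<beta> = radial CARD('d) a (multi_abs \<beta>) \<Otimes>\<^sub>M spherical \<beta>"

text \<open>The product of the two Borel algebras is the Borel algebra of the product type, in terms
  of which operator measures are defined.\<close>

lemma sets_block_measure[simp, measurable_cong]: "sets (block_measure a \<beta>) = sets borel"
  unfolding block_measure_def borel_prod[symmetric] by (intro sets_pair_measure_cong) simp_all

lemma space_block_measure[simp]: "space (block_measure a \<beta>) = UNIV"
  by (simp add: block_measure_def space_pair_measure)

lemma prob_space_block_measure: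
  assumes "0 < a" "a < CARD('d::finite)"
  shows "prob_space (block_measure a (\<beta> :: 'd \<Rightarrow> nat))"
proof -
  interpret A: prob_space "radial CARD('d) a (multi_abs \<beta>)" by (rule prob_space_radial[OF assms])
  interpret B: prob_space "spherical \<beta>" by (rule prob_space_spherical)
  interpret pair_prob_space "radial CARD('d) a (multi_abs \<beta>)" "spherical \<beta>" ..
  show ?thesis unfolding block_measure_def by (rule prob_space_axioms)
qed

lemma AE_block_measure:
  assumes "0 < a" "a < CARD('d::finite)"
  shows "AE p in block_measure a (\<beta> :: 'd \<Rightarrow> nat). p \<in> {0..1} \<times> sphere 0 1"
proof -
  interpret A: prob_space "radial CARD('d) a (multi_abs \<beta>)" by (rule prob_space_radial[OF assms])
  interpret B: prob_space "spherical \<beta>" by (rule prob_space_spherical)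
  interpret pair_prob_space "radial CARD('d) a (multi_abs \<beta>)" "spherical \<beta>" ..
  have "{0..1::real} \<times> sphere (0 :: complex ^ 'd) 1 \<in> sets borel"
    by (intro borel_closed closed_Times) auto
  then have "{p \<in> space (radial CARD('d) a (multi_abs \<beta>) \<Otimes>\<^sub>M spherical \<beta>). p \<in> {0..1} \<times> sphere 0 1}
      \<in> sets (radial CARD('d) a (multi_abs \<beta>) \<Otimes>\<^sub>M spherical \<beta>)"
    unfolding block_measure_def[symmetric] by simp
  moreover have "AE s in radial CARD('d) a (multi_abs \<beta>). AE z in spherical \<beta>. (s, z) \<in> {0..1} \<times> sphere 0 1"
    using AE_radial[OF assms]
  proof eventually_elim
    case (elim s)
    show ?case using AE_spherical by eventually_elim (use elim in auto)
  qed
  ultimately show ?thesis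
    unfolding block_measure_def by (rule AE_pair_measure)
qed

text \<open>Up to a constant factor, \<open>model_weight\<close> is the squared norm of \<open>z\<^sup>\<gamma>\<close> on the product of rays, where the
  spherical Cauchy dual is a classical weighted multishift.\<close>

definition model_weight :: "nat \<Rightarrow> ('d::finite \<Rightarrow> nat) \<Rightarrow> real" where
  "model_weight a \<gamma> = multi_fact \<gamma> * fact (multi_abs \<gamma> + a - 1) / (fact (multi_abs \<gamma> + CARD('d) - 1))\<^sup>2"

lemma model_weight_pos: "model_weight a \<gamma> > 0"
  by (simp add: model_weight_def prod_pos)

lemma multi_abs_fun_upd_Suc: "multi_abs (\<beta>(j := Suc (\<beta> j))) = Suc (multi_abs \<beta>)"
  unfolding multi_abs_def by (subst (1 2) sum.remove[of _ j]) auto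

text \<open>The factor is the squared norm of the j-th dual operator on a basis vector of depth
  \<beta>: the square of (|\<beta>| + a) / (|\<beta>| + d) times (\<beta>_j + 1) / (|\<beta>| +
  a).\<close>

lemma model_weight_Suc:
  fixes \<beta> :: "'d::finite \<Rightarrow> nat"
  assumes "0 < a"
  shows "model_weight a (\<beta>(j := Suc (\<beta> j)))
    = model_weight a \<beta> * ((real (\<beta> j) + 1) * (multi_abs \<beta> + a) / (multi_abs \<beta> + CARD('d))\<^sup>2)"
proof -
  let ?n = "multi_abs \<beta>" and ?d = "CARD('d)"
  have 1: "multi_fact (\<beta>(j := Suc (\<beta> j))) = (real (\<beta> j) + 1) * multi_fact \<beta>"
    by (subst (1 2) prod.remove[of _ j]) (auto simp: algebra_simps)
  have 2: "(fact (Suc ?n + a - 1) :: real) = (?n + a) * fact (?n + a - 1)"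
  proof -
    have "Suc ?n + a - 1 = Suc (?n + a - 1)" using assms by linarith
    moreover have "real (Suc (?n + a - 1)) = ?n + a" using assms by linarith
    ultimately show ?thesis by (metis fact_Suc of_nat_fact of_nat_mult)
  qed
  have 3: "(fact (Suc ?n + ?d - 1) :: real) = (?n + ?d) * fact (?n + ?d - 1)"
  proof -
    have "?d > 0" by simp
    then have "Suc ?n + ?d - 1 = Suc (?n + ?d - 1)" "real (Suc (?n + ?d - 1)) = ?n + ?d" by linarith+
    then show ?thesis by (metis fact_Suc of_nat_fact of_nat_mult)
  qed
  show ?thesis
    unfolding model_weight_def multi_abs_fun_upd_Suc 1 2 3 by (simp add: power_mult_distrib mult_ac)
qed

text \<open>Of the two factors (|\<gamma>| + d - 1)! in the denominator of
  \<open>model_weight\<close>, one belongs to the radial and one to the spherical moment; in the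
  numerator (|\<gamma>| + a - 1)! is radial and \<gamma>! spherical.\<close>

lemma block_moment:
  fixes \<alpha> \<beta> :: "'d::finite \<Rightarrow> nat"
  assumes "0 < a" "a < CARD('d)"
  shows "(\<integral>\<^sup>+p\<in>{0..1} \<times> sphere 0 1. ennreal (fst p ^ multi_abs \<alpha> * (cmod (zpow (snd p) \<alpha>))\<^sup>2) \<partial>block_measure a \<beta>)
    = ennreal (model_weight a (\<lambda>j. \<beta> j + \<alpha> j) / model_weight a \<beta>)"
proof -
  let ?l = "multi_abs \<beta>" and ?k = "multi_abs \<alpha>"
  interpret B: prob_space "spherical \<beta>" by (rule prob_space_spherical)
  let ?g = "\<lambda>p :: real \<times> (complex ^ 'd). ennreal (fst p ^ ?k) * ennreal ((cmod (zpow (snd p) \<alpha>))\<^sup>2)"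
  have [measurable]: "?g \<in> borel_measurable borel" unfolding borel_prod[symmetric] by measurable
  have "(\<integral>\<^sup>+p\<in>{0..1} \<times> sphere 0 1. ennreal (fst p ^ ?k * (cmod (zpow (snd p) \<alpha>))\<^sup>2) \<partial>block_measure a \<beta>)
      = (\<integral>\<^sup>+p. ?g p \<partial>block_measure a \<beta>)"
    using AE_block_measure[OF assms, of \<beta>]
    by (intro nn_integral_cong_AE) (auto elim!: eventually_mono simp: ennreal_mult)
  also have "\<dots> = (\<integral>\<^sup>+s. (\<integral>\<^sup>+z. ?g (s, z) \<partial>spherical \<beta>) \<partial>radial CARD('d) a ?l)"
    unfolding block_measure_def by (rule B.nn_integral_fst[symmetric]) measurable
  also have "\<dots> = (\<integral>\<^sup>+s. ennreal (s ^ ?k) \<partial>radial CARD('d) a ?l) * (\<integral>\<^sup>+z. ennreal ((cmod (zpow z \<alpha>))\<^sup>2) \<partial>spherical \<beta>)"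
    by (simp add: nn_integral_cmult nn_integral_multc)
  also have "\<dots> = ennreal (model_weight a (\<lambda>j. \<beta> j + \<alpha> j) / model_weight a \<beta>)"
  proof -
    have comm: "(\<lambda>j. \<beta> j + \<alpha> j) = (\<lambda>j. \<alpha> j + \<beta> j)" by (simp add: add.commute)
    show ?thesis
      unfolding radial_moment[OF assms] spherical_moment comm model_weight_def multi_abs_add
      by (subst ennreal_mult'[symmetric]) (simp_all add: power2_eq_square mult_ac)
  qed
  finally show ?thesis .
qed

section \<open>Rooted trees and their products\<close>

locale rooted_tree =
  fixes G :: "'v pair_pre_digraph"
  assumes rooted: "rooted_directed_tree G"
begin

lemma unique_root: "\<exists>!r. r \<in> pverts G \<and> parents G r = {}"
  using rooted by (simp add: rooted_directed_tree_def)

lemma arc_in_verts: "(u, w) \<in> parcs G \<Longrightarrow> u \<in> pverts G \<and> w \<in> pverts G"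
proof -
  have "pair_wf_digraph G" using rooted by (simp add: rooted_directed_tree_def)
  then show "(u, w) \<in> parcs G \<Longrightarrow> u \<in> pverts G \<and> w \<in> pverts G"
    by (auto simp: pair_wf_digraph_def)
qed

lemma unique_parent:
  assumes "(u, w) \<in> parcs G" "(u', w) \<in> parcs G"
  shows "u = u'"
proof -
  have "\<forall>w\<in>pverts G. \<forall>u\<in>parents G w. \<forall>u'\<in>parents G w. u = u'"
    using rooted by (simp add: rooted_directed_tree_def)
  moreover have "w \<in> pverts G" "u \<in> parents G w" "u' \<in> parents G w"
    using assms arc_in_verts by (simp_all add: parents_def)
  ultimately show ?thesis by blast
qed

lemma root: "tree_root G \<in> pverts G" "parents G (tree_root G) = {}"
  using theI'[OF unique_root] by (simp_all add: tree_root_def)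

lemma not_arc_root: "(u, tree_root G) \<notin> parcs G"
  using root(2) by (auto simp: parents_def)

lemma parent_arc: "w \<in> pverts G \<Longrightarrow> w \<noteq> tree_root G \<Longrightarrow> (parent G w, w) \<in> parcs G"
proof -
  assume w: "w \<in> pverts G" "w \<noteq> tree_root G"
  then have "parents G w \<noteq> {}" using unique_root root by metis
  then obtain u where u: "(u, w) \<in> parcs G" by (auto simp: parents_def)
  then have "parent G w = u" unfolding parent_def parents_def
    by (intro the_equality) (auto dest: unique_parent)
  with u show ?thesis by simp
qed

lemma parent_eq: "(u, w) \<in> parcs G \<Longrightarrow> parent G w = u"
  by (rule unique_parent[OF parent_arc]) (auto simp: not_arc_root dest: arc_in_verts)

lemma children_iff: "w \<in> children G u \<longleftrightarrow> w \<in> pverts G \<and> w \<noteq> tree_root G \<and> parent G w = u"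
proof
  assume "w \<in> children G u"
  then have "(u, w) \<in> parcs G" by (simp add: children_def)
  then show "w \<in> pverts G \<and> w \<noteq> tree_root G \<and> parent G w = u"
    using arc_in_verts[of u w] parent_eq[of u w] not_arc_root[of u] by auto
next
  assume "w \<in> pverts G \<and> w \<noteq> tree_root G \<and> parent G w = u"
  then show "w \<in> children G u"
    using parent_arc[of w] by (auto simp: children_def)
qed

text \<open>Weak connectedness gives only an undirected path. A step taken backwards, from
  \<open>y\<close> to its parent \<open>z\<close>, shortens the directed path found so far:
  \<open>y\<close> is not the root, and by uniqueness of parents its last arc leaves
  \<open>z\<close>.\<close>

lemma root_reaches: "v \<in> pverts G \<Longrightarrow> (tree_root G, v) \<in> (parcs G)\<^sup>*"
proof -
  assume v: "v \<in> pverts G"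
  have "Digraph_Component.connected (with_proj G)"
    using rooted by (simp add: rooted_directed_tree_def)
  then have "(tree_root G, v) \<in> rtrancl_on (pverts G) (parcs (mk_symmetric (with_proj G)))"
    using v root(1) by (auto simp: connected_def strongly_connected_def reachable_def)
  then show ?thesis
  proof (induction rule: rtrancl_on_induct)
    case base
    then show ?case by simp
  next
    case (step y z)
    then have "(y, z) \<in> parcs G \<or> (z, y) \<in> parcs G"
      by (auto simp: mk_symmetric_def)
    then show ?case
    proof
      assume "(z, y) \<in> parcs G"
      moreover from this have "y \<noteq> tree_root G" using not_arc_root by auto
      ultimately obtain y' where "(tree_root G, y') \<in> (parcs G)\<^sup>*" "(y', y) \<in> parcs G"
        using step.IH by (auto elim: rtranclE)
      with \<open>(z, y) \<in> parcs G\<close> show ?thesis using unique_parent[of z y y'] by simp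
    qed (use step.IH in auto)
  qed
qed

text \<open>Both paths are peeled from the end: unique parents force the same predecessor, and no
  arc enters the root. This gives the definite description in \<open>depth\<close> its
  meaning.\<close>

lemma depth_unique: "(tree_root G, u) \<in> parcs G ^^ n \<Longrightarrow> (tree_root G, u) \<in> parcs G ^^ m \<Longrightarrow> n = m"
proof (induction n arbitrary: m u)
  case 0
  then show ?case by (cases m) (auto simp: not_arc_root)
next
  case (Suc n)
  then obtain v where v: "(tree_root G, v) \<in> parcs G ^^ n" "(v, u) \<in> parcs G" by auto
  then obtain m' where m': "m = Suc m'" using Suc.prems not_arc_root by (cases m) auto
  with Suc.prems(2) obtain v' where v': "(tree_root G, v') \<in> parcs G ^^ m'" "(v', u) \<in> parcs G" by auto
  have "(tree_root G, v) \<in> parcs G ^^ m'" using v' unique_parent[OF v(2) v'(2)] by simp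
  with Suc.IH[OF v(1)] m' show ?case by simp
qed

lemma depth_eq: "(tree_root G, u) \<in> parcs G ^^ n \<Longrightarrow> depth G u = n"
  unfolding depth_def by (rule the_equality) (auto dest: depth_unique)

lemma depth_arc: "(u, w) \<in> parcs G \<Longrightarrow> depth G w = Suc (depth G u)"
proof -
  assume uw: "(u, w) \<in> parcs G"
  then obtain n where n: "(tree_root G, u) \<in> parcs G ^^ n"
    using root_reaches arc_in_verts rtrancl_power by blast
  then have "(tree_root G, w) \<in> parcs G ^^ Suc n" using uw by auto
  with n show ?thesis using depth_eq by metis
qed

end

section \<open>The shift and its Cauchy dual in coordinates\<close>

locale multishift =
  fixes T :: "'d::finite \<Rightarrow> 'v pair_pre_digraph" and a :: nat
  assumes trees: "\<And>j. rooted_directed_tree (T j)"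
    and leafless: "\<And>j. leafless (T j)"
    and loc_finite: "\<And>j. locally_finite (T j)"
    and a_pos: "0 < a"
begin

sublocale tree: rooted_tree "T j" for j
  by standard (rule trees)

definition par :: "'d \<Rightarrow> ('d \<Rightarrow> 'v) \<Rightarrow> ('d \<Rightarrow> 'v)" where
  "par j x = x(j := parent (T j) (x j))"

definition non_root :: "'d \<Rightarrow> ('d \<Rightarrow> 'v) set" where
  "non_root j = {x \<in> vertices T. x j \<noteq> tree_root (T j)}"

abbreviation dep :: "('d \<Rightarrow> 'v) \<Rightarrow> 'd \<Rightarrow> nat" where "dep \<equiv> prod_depth T"

lemma vertices_iff: "v \<in> vertices T \<longleftrightarrow> (\<forall>j. v j \<in> pverts (T j))"
  by (simp add: directed_product_def)

lemma non_root_vertex: "x \<in> non_root j \<Longrightarrow> x \<in> vertices T"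
  by (simp add: non_root_def)

lemma parent_arc: "x \<in> non_root j \<Longrightarrow> (parent (T j) (x j), x j) \<in> parcs (T j)"
  by (rule tree.parent_arc) (auto simp: non_root_def vertices_iff)

text \<open>The sets of j-children are the fibres of \<open>par j\<close> on
  \<open>non_root j\<close>; the later rearrangements of sums rest on this.\<close>

lemma Chi_iff: "w \<in> Chi T j v \<longleftrightarrow> w \<in> non_root j \<and> par j w = v"
  by (auto simp: Chi_def non_root_def par_def tree.children_iff vertices_iff fun_eq_iff)

lemma par_vertex: "x \<in> non_root j \<Longrightarrow> par j x \<in> vertices T"
  using parent_arc[of x j] tree.arc_in_verts[of _ _ j]
  by (auto simp: par_def vertices_iff non_root_def)

lemma depth_par: "x \<in> non_root j \<Longrightarrow> dep x = (dep (par j x))(j := Suc (dep (par j x) j))"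
  using tree.depth_arc[OF parent_arc, of x j] by (auto simp: prod_depth_def par_def)

lemma depth_Chi: "w \<in> Chi T j v \<Longrightarrow> dep w = (dep v)(j := Suc (dep v j))"
  using depth_par Chi_iff by auto

lemma Chi_bij: "v \<in> vertices T \<Longrightarrow> bij_betw (\<lambda>w. w j) (Chi T j v) (children (T j) (v j))"
  by (rule bij_betw_byWitness[where f' = "\<lambda>x. v(j := x)"])
     (auto simp: Chi_def vertices_iff tree.children_iff fun_eq_iff)

lemma card_Chi: "v \<in> vertices T \<Longrightarrow> card (Chi T j v) = card (children (T j) (v j))"
  by (rule bij_betw_same_card[OF Chi_bij])

lemma finite_children: "v \<in> vertices T \<Longrightarrow> finite (children (T j) (v j))"
  using loc_finite[of j] by (auto simp: locally_finite_def vertices_iff)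

lemma Chi_empty: "v \<notin> vertices T \<Longrightarrow> Chi T j v = {}"
  using par_vertex by (auto simp: Chi_iff)

lemma finite_Chi: "finite (Chi T j v)"
proof (cases "v \<in> vertices T")
  case True
  then show ?thesis
    using Chi_bij[of v j] finite_children[of v j] by (simp add: bij_betw_finite)
qed (simp add: Chi_empty)

lemma card_Chi_pos: "v \<in> vertices T \<Longrightarrow> card (Chi T j v) > 0"
  using leafless[of j] finite_children[of v j]
  by (auto simp: card_Chi leafless_def vertices_iff card_gt_0_iff)

lemma weight_eq:
  "weight T a j x = 1 / sqrt (card (Chi T j (par j x)))
     * sqrt ((real (dep (par j x) j) + 1) / (real (multi_abs (dep (par j x))) + real a))"
  by (simp add: weight_def par_def Let_def)

lemma weight_power2:
  "x \<in> non_root j \<Longrightarrow> (weight T a j x)\<^sup>2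
     = (real (dep (par j x) j) + 1) / (real (multi_abs (dep (par j x))) + real a) / card (Chi T j (par j x))"
  by (simp add: weight_eq power_mult_distrib power_divide)

text \<open>The reciprocal cardinality in the squared weight compensates the number of children, so
  branching leaves no trace and only the depth of \<open>v\<close> matters.\<close>

lemma sum_weight_power2:
  assumes "v \<in> vertices T"
  shows "(\<Sum>w\<in>Chi T j v. (weight T a j w)\<^sup>2) = (real (dep v j) + 1) / (real (multi_abs (dep v)) + real a)"
proof -
  have "(\<Sum>w\<in>Chi T j v. (weight T a j w)\<^sup>2)
      = (\<Sum>w\<in>Chi T j v. (real (dep v j) + 1) / (real (multi_abs (dep v)) + real a) / card (Chi T j v))"
    by (intro sum.cong refl) (auto simp: Chi_iff weight_power2)
  then show ?thesis using card_Chi_pos[OF assms, of j] by simp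
qed

lemma shift_on_basis_eq:
  assumes "v \<in> vertices T"
  shows "shift_on_basis T a j v x = (if x \<in> non_root j \<and> par j x = v then complex_of_real (weight T a j x) else 0)"
proof -
  have "shift_on_basis T a j v x = (\<Sum>w\<in>Chi T j v. if w = x then complex_of_real (weight T a j w) else 0)"
    unfolding shift_on_basis_def by (intro sum.cong) (auto simp: l2_basis_def)
  then show ?thesis using finite_Chi by (simp add: Chi_iff)
qed

text \<open>In the coordinate \<open>x\<close> only the basis vector at \<open>par j x\<close>
  contributes. The free factor \<open>c\<close> serves the shift, with \<open>c\<close> equal to 1,
  and its Cauchy dual at once.\<close>

lemma op_of_shift:
  "op_of_basis (vertices T) (\<lambda>v x. c v * shift_on_basis T a j v x) f x
    = (if x \<in> non_root j then f (par j x) * c (par j x) * complex_of_real (weight T a j x) else 0)"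
proof (cases "x \<in> non_root j")
  case True
  have "(\<Sum>\<^sub>\<infinity>v\<in>vertices T. f v * (c v * shift_on_basis T a j v x))
      = (\<Sum>\<^sub>\<infinity>v\<in>{par j x}. f v * (c v * shift_on_basis T a j v x))"
    using par_vertex[OF True] by (intro infsum_cong_neutral) (auto simp: shift_on_basis_eq)
  then show ?thesis
    using True par_vertex[OF True] by (simp add: op_of_basis_def shift_on_basis_eq)
next
  case False
  then show ?thesis
    by (simp add: op_of_basis_def) (rule infsum_0, simp add: shift_on_basis_eq)
qed

lemma DA_shift_eq:
  "DA_shift T a j f x = (if x \<in> non_root j then f (par j x) * complex_of_real (weight T a j x) else 0)"
  using op_of_shift[of "\<lambda>_. 1" j f x] by (simp add: DA_shift_def)

lemma norm_DA_shift_basis: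
  assumes v: "v \<in> vertices T"
  shows "(l2_norm (vertices T) (DA_shift T a j (l2_basis v)))\<^sup>2
    = (real (dep v j) + 1) / (real (multi_abs (dep v)) + real a)"
proof -
  have "(\<Sum>\<^sub>\<infinity>x\<in>vertices T. (cmod (DA_shift T a j (l2_basis v) x))\<^sup>2)
      = (\<Sum>\<^sub>\<infinity>x\<in>Chi T j v. (weight T a j x)\<^sup>2)"
    by (intro infsum_cong_neutral)
       (auto simp: DA_shift_eq l2_basis_def Chi_iff norm_mult dest: non_root_vertex)
  also have "\<dots> = (real (dep v j) + 1) / (real (multi_abs (dep v)) + real a)"
    using finite_Chi by (simp add: sum_weight_power2[OF v])
  finally show ?thesis by (simp add: l2_norm_def)
qed

text \<open>The reciprocal of the total squared norm at depth \<open>n\<close>: the numerators, one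
  more than each coordinate of the depth, add up to \<open>n + CARD('d)\<close>.\<close>

definition dual_factor :: "nat \<Rightarrow> real" where
  "dual_factor n = (real n + real a) / (real n + CARD('d))"

lemma inverse_sum_norm:
  assumes v: "v \<in> vertices T"
  shows "inverse (\<Sum>i\<in>UNIV. (l2_norm (vertices T) (DA_shift T a i (l2_basis v)))\<^sup>2) = dual_factor (multi_abs (dep v))"
proof -
  have "(\<Sum>i\<in>UNIV. (l2_norm (vertices T) (DA_shift T a i (l2_basis v)))\<^sup>2)
      = (\<Sum>i\<in>UNIV. real (dep v i) + 1) / (real (multi_abs (dep v)) + real a)"
    by (simp add: norm_DA_shift_basis[OF v] sum_divide_distrib)
  then show ?thesis by (simp add: dual_factor_def multi_abs_def sum.distrib)
qed

lemma cauchy_dual_eq: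
  "cauchy_dual T a j f x = (if x \<in> non_root j
     then f (par j x) * complex_of_real (dual_factor (multi_abs (dep (par j x))) * weight T a j x) else 0)"
  using op_of_shift[of "\<lambda>v. complex_of_real (inverse (\<Sum>i\<in>UNIV. (l2_norm (vertices T) (DA_shift T a i (l2_basis v)))\<^sup>2))" j f x]
  by (auto simp: cauchy_dual_def inverse_sum_norm par_vertex)

lemma par_commute: "i \<noteq> j \<Longrightarrow> par i (par j x) = par j (par i x)"
  by (auto simp: par_def fun_eq_iff)

lemma non_root_par: "i \<noteq> j \<Longrightarrow> x \<in> non_root j \<Longrightarrow> par j x \<in> non_root i \<longleftrightarrow> x \<in> non_root i"
  using par_vertex[of x j] non_root_vertex[of x j] by (auto simp: non_root_def par_def)

text \<open>In terms of \<open>x\<close> instead of its parent, the child count depends on the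
  coordinate \<open>x j\<close> alone and the rest on the depth of \<open>x\<close>. This makes
  visible that the weights picked up in two directions do not depend on their order.\<close>

lemma weight_non_root:
  assumes "x \<in> non_root j"
  shows "weight T a j x = 1 / sqrt (card (children (T j) (parent (T j) (x j))))
     * sqrt (real (dep x j)) / sqrt (real (multi_abs (dep x)) - 1 + real a)"
proof -
  have "multi_abs (dep x) = Suc (multi_abs (dep (par j x)))"
    using depth_par[OF assms] multi_abs_fun_upd_Suc by metis
  moreover have "dep x j = Suc (dep (par j x) j)"
    using depth_par[OF assms] by (metis fun_upd_same)
  ultimately show ?thesis
    by (simp add: weight_eq card_Chi par_vertex[OF assms] real_sqrt_divide) (simp add: par_def)
qed

text \<open>Both compositions read \<open>f\<close> at the same vertex two steps back, and the total
  depth drops by one in either order, so the accumulated factors agree. Commutation is what allows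
  the fold in \<open>tuple_power\<close> to be unfolded.\<close>

lemma cauchy_dual_commute:
  "cauchy_dual T a i \<circ> cauchy_dual T a j = cauchy_dual T a j \<circ> cauchy_dual T a i"
proof (cases "i = j")
  case False
  have aux: "weight T a j (par i x) * weight T a i x = weight T a i (par j x) * weight T a j x
      \<and> multi_abs (dep (par i x)) = multi_abs (dep (par j x))"
    if "x \<in> non_root i" "x \<in> non_root j" for x
  proof -
    have nr: "par i x \<in> non_root j" "par j x \<in> non_root i"
      using that False non_root_par[of j i x] non_root_par[of i j x] by auto
    have "multi_abs (dep x) = Suc (multi_abs (dep (par i x)))" "multi_abs (dep x) = Suc (multi_abs (dep (par j x)))"
      using depth_par that multi_abs_fun_upd_Suc by metis+
    then have eq: "multi_abs (dep (par i x)) = multi_abs (dep (par j x))" by simp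
    have "dep (par i x) j = dep x j" "dep (par j x) i = dep x i" "par i x j = x j" "par j x i = x i"
      using False by (auto simp: prod_depth_def par_def)
    then show ?thesis
      using eq by (simp add: weight_non_root that nr mult_ac)
  qed
  show ?thesis
  proof (intro ext)
    fix f x
    show "(cauchy_dual T a i \<circ> cauchy_dual T a j) f x = (cauchy_dual T a j \<circ> cauchy_dual T a i) f x"
    proof (cases "x \<in> non_root i \<and> x \<in> non_root j")
      case True
      then show ?thesis
        using False aux[of x]
        by (simp add: cauchy_dual_eq non_root_par par_commute[OF False]) (simp add: mult_ac flip: of_real_mult)
    next
      case F: False
      then show ?thesis using False non_root_par[of i j x] non_root_par[of j i x]
        by (auto simp: cauchy_dual_eq)
    qed
  qed
qed simp

end

section \<open>The joint kernel\<close>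

lemma nn_integral_count_space_summable:
  fixes f :: "'x \<Rightarrow> real"
  assumes "\<And>x. x \<in> A \<Longrightarrow> f x \<ge> 0" "f summable_on A"
  shows "(\<integral>\<^sup>+x. ennreal (f x) \<partial>count_space A) = ennreal (\<Sum>\<^sub>\<infinity>x\<in>A. f x)"
proof -
  have "Infinite_Set_Sum.abs_summable_on f A"
    using assms(2) summable_on_iff_abs_summable_on_real[of f A] abs_summable_equivalent[of f A] by blast
  then show ?thesis
    using assms(1) by (simp add: nn_integral_conv_infsetsum infsetsum_infsum)
qed

lemma summable_on_if_nn_integral_finite:
  fixes f :: "'x \<Rightarrow> real"
  assumes "\<And>x. x \<in> A \<Longrightarrow> f x \<ge> 0" "(\<integral>\<^sup>+x. ennreal (f x) \<partial>count_space A) < \<infinity>"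
  shows "f summable_on A"
proof -
  have "(\<integral>\<^sup>+x. ennreal (norm (f x)) \<partial>count_space A) = (\<integral>\<^sup>+x. ennreal (f x) \<partial>count_space A)"
    by (intro nn_integral_cong) (simp add: assms(1))
  then have "Infinite_Set_Sum.abs_summable_on f A"
    using assms by (simp add: Infinite_Set_Sum.abs_summable_on_def integrable_iff_bounded)
  then show ?thesis
    using summable_on_iff_abs_summable_on_real[of f A] abs_summable_equivalent[of f A] by blast
qed

lemma nn_integral_count_space_extend:
  assumes "\<And>v. v \<notin> V \<Longrightarrow> g v = 0"
  shows "(\<integral>\<^sup>+v. g v \<partial>count_space UNIV) = (\<integral>\<^sup>+v. g v \<partial>count_space V)"
  by (rule nn_integral_count_space_eq) (auto simp: assms)

lemma l2_iff:
  "f \<in> l2 V \<longleftrightarrow> (\<forall>v. v \<notin> V \<longrightarrow> f v = 0) \<and> (\<integral>\<^sup>+v. ennreal ((cmod (f v))\<^sup>2) \<partial>count_space UNIV) < \<infinity>"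
proof (cases "\<forall>v. v \<notin> V \<longrightarrow> f v = 0")
  case True
  then have eq: "(\<integral>\<^sup>+v. ennreal ((cmod (f v))\<^sup>2) \<partial>count_space UNIV) = (\<integral>\<^sup>+v. ennreal ((cmod (f v))\<^sup>2) \<partial>count_space V)"
    by (intro nn_integral_count_space_extend) auto
  show ?thesis
  proof
    assume "f \<in> l2 V"
    with True show "(\<forall>v. v \<notin> V \<longrightarrow> f v = 0) \<and> (\<integral>\<^sup>+v. ennreal ((cmod (f v))\<^sup>2) \<partial>count_space UNIV) < \<infinity>"
      unfolding eq by (auto simp: l2_def nn_integral_count_space_summable)
  next
    assume "(\<forall>v. v \<notin> V \<longrightarrow> f v = 0) \<and> (\<integral>\<^sup>+v. ennreal ((cmod (f v))\<^sup>2) \<partial>count_space UNIV) < \<infinity>"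
    then show "f \<in> l2 V"
      unfolding eq l2_def by (auto intro: summable_on_if_nn_integral_finite)
  qed
next
  case False
  then show ?thesis by (auto simp: l2_def)
qed

lemma l2_norm_power2: "(l2_norm V f)\<^sup>2 = (\<Sum>\<^sub>\<infinity>v\<in>V. (cmod (f v))\<^sup>2)"
  by (simp add: l2_norm_def infsum_nonneg)

lemma ennreal_l2_norm_power2:
  assumes "f \<in> l2 V"
  shows "ennreal ((l2_norm V f)\<^sup>2) = (\<integral>\<^sup>+v. ennreal ((cmod (f v))\<^sup>2) \<partial>count_space UNIV)"
proof -
  have "(\<integral>\<^sup>+v. ennreal ((cmod (f v))\<^sup>2) \<partial>count_space UNIV) = (\<integral>\<^sup>+v. ennreal ((cmod (f v))\<^sup>2) \<partial>count_space V)"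
    using assms by (intro nn_integral_count_space_extend) (auto simp: l2_def)
  with assms show ?thesis
    by (simp add: l2_def l2_norm_power2 nn_integral_count_space_summable)
qed

lemma l2_inner_abs_summable:
  assumes "f \<in> l2 V" "g \<in> l2 V"
  shows "(\<lambda>v. norm (f v * cnj (g v))) summable_on V"
proof (rule abs_summable_product)
  show "(\<lambda>v. norm (f v * f v)) summable_on V"
    using assms(1) by (simp add: l2_def norm_mult power2_eq_square)
  show "(\<lambda>v. norm (cnj (g v) * cnj (g v))) summable_on V"
    using assms(2) by (simp add: l2_def norm_mult power2_eq_square)
qed

lemma l2_basis_in_l2:
  assumes "v \<in> V"
  shows "l2_basis v \<in> l2 V"
proof -
  have "(\<lambda>x. (cmod (l2_basis v x))\<^sup>2) summable_on V \<longleftrightarrow> (\<lambda>x. (cmod (l2_basis v x))\<^sup>2) summable_on {v}"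
    using assms by (intro summable_on_cong_neutral) (auto simp: l2_basis_def)
  then show ?thesis using assms by (auto simp: l2_def l2_basis_def)
qed

lemma l2_inner_basis: "v \<in> V \<Longrightarrow> l2_inner V (l2_basis v) h = cnj (h v)"
proof -
  assume "v \<in> V"
  then have "(\<Sum>\<^sub>\<infinity>x\<in>V. l2_basis v x * cnj (h x)) = (\<Sum>\<^sub>\<infinity>x\<in>{v}. l2_basis v x * cnj (h x))"
    by (intro infsum_cong_neutral) (auto simp: l2_basis_def)
  then show ?thesis by (simp add: l2_inner_def l2_basis_def)
qed

text \<open>Testing with basis vectors determines the values on \<open>V\<close>, and outside
  \<open>V\<close> both candidates vanish, so the definite description picks out
  \<open>h\<close>.\<close>

lemma l2_adjoint_eqI:
  assumes "h \<in> l2 V" "\<And>g. g \<in> l2 V \<Longrightarrow> l2_inner V (S g) f = l2_inner V g h"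
  shows "l2_adjoint V S f = h"
  unfolding l2_adjoint_def
proof (rule the_equality)
  fix h' assume h': "h' \<in> l2 V \<and> (\<forall>g\<in>l2 V. l2_inner V (S g) f = l2_inner V g h')"
  show "h' = h"
  proof
    fix v
    show "h' v = h v"
    proof (cases "v \<in> V")
      case True
      then have "cnj (h' v) = cnj (h v)"
        using h' assms(2) l2_basis_in_l2[OF True] by (metis l2_inner_basis)
      then show ?thesis by simp
    qed (use h' assms(1) in \<open>auto simp: l2_def\<close>)
  qed
qed (use assms in auto)

section \<open>Adjoints of the shifts\<close>

context multishift
begin

text \<open>Tonelli over pairs of a vertex and one of its j-children: each child has
  \<open>par j\<close> of itself as its only partner.\<close>

lemma nn_integral_non_root:
  "(\<integral>\<^sup>+x. F x * indicator (non_root j) x \<partial>count_space UNIV) = (\<integral>\<^sup>+v. (\<Sum>w\<in>Chi T j v. F w) \<partial>count_space UNIV)"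
proof -
  let ?G = "\<lambda>(v, x). F x * indicator (Chi T j v) x"
  have "(\<integral>\<^sup>+x. F x * indicator (non_root j) x \<partial>count_space UNIV)
      = (\<integral>\<^sup>+x. (\<integral>\<^sup>+v. F x * indicator (non_root j) x * indicator {par j x} v \<partial>count_space UNIV) \<partial>count_space UNIV)"
    by (intro nn_integral_cong) (simp add: nn_integral_cmult_indicator)
  also have "\<dots> = (\<integral>\<^sup>+x. (\<integral>\<^sup>+v. ?G (v, x) \<partial>count_space UNIV) \<partial>count_space UNIV)"
    by (intro nn_integral_cong) (auto simp: Chi_iff split: split_indicator)
  also have "\<dots> = (\<integral>\<^sup>+v. (\<integral>\<^sup>+x. ?G (v, x) \<partial>count_space UNIV) \<partial>count_space UNIV)"
    by (simp only: nn_integral_snd_count_space nn_integral_fst_count_space)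
  also have "\<dots> = (\<integral>\<^sup>+v. (\<Sum>w\<in>Chi T j v. F w) \<partial>count_space UNIV)"
    by (intro nn_integral_cong) (simp add: nn_integral_indicator_finite finite_Chi)
  finally show ?thesis .
qed

definition adjoint_shift :: "'d \<Rightarrow> (('d \<Rightarrow> 'v) \<Rightarrow> complex) \<Rightarrow> (('d \<Rightarrow> 'v) \<Rightarrow> complex)" where
  "adjoint_shift j f v = (\<Sum>w\<in>Chi T j v. f w * complex_of_real (weight T a j w))"

text \<open>This is contractivity of the shift in direction j. It rests on
  \<open>dep v j + 1 \<le> multi_abs (dep v) + a\<close>, where positivity of the integer
  \<open>a\<close> supplies the 1.\<close>

lemma sum_weight_le: "(\<Sum>w\<in>Chi T j v. (weight T a j w)\<^sup>2) \<le> 1"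
proof (cases "v \<in> vertices T")
  case True
  have "dep v j \<le> multi_abs (dep v)"
    unfolding multi_abs_def by (intro member_le_sum) auto
  moreover have "1 \<le> a" using a_pos by simp
  ultimately have "real (dep v j) + 1 \<le> real (multi_abs (dep v)) + real a" by linarith
  then show ?thesis by (simp add: sum_weight_power2[OF True] divide_le_eq_1)
qed (simp add: Chi_empty)

lemma adjoint_shift_in_l2:
  assumes "f \<in> l2 (vertices T)"
  shows "adjoint_shift j f \<in> l2 (vertices T)"
proof -
  have "(cmod (adjoint_shift j f v))\<^sup>2 \<le> (\<Sum>w\<in>Chi T j v. (cmod (f w))\<^sup>2)" for v
  proof -
    have "cmod (adjoint_shift j f v) \<le> (\<Sum>w\<in>Chi T j v. cmod (f w) * \<bar>weight T a j w\<bar>)"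
      unfolding adjoint_shift_def by (rule order_trans[OF norm_sum]) (simp add: norm_mult)
    then have "(cmod (adjoint_shift j f v))\<^sup>2 \<le> (\<Sum>w\<in>Chi T j v. cmod (f w) * \<bar>weight T a j w\<bar>)\<^sup>2"
      by (intro power_mono) auto
    also have "\<dots> \<le> (\<Sum>w\<in>Chi T j v. (cmod (f w))\<^sup>2) * (\<Sum>w\<in>Chi T j v. \<bar>weight T a j w\<bar>\<^sup>2)"
      by (rule Cauchy_Schwarz_ineq_sum)
    also have "\<dots> \<le> (\<Sum>w\<in>Chi T j v. (cmod (f w))\<^sup>2) * 1"
      using sum_weight_le[of j v] by (intro mult_left_mono) (auto simp: sum_nonneg)
    finally show ?thesis by simp
  qed
  then have "(\<integral>\<^sup>+v. ennreal ((cmod (adjoint_shift j f v))\<^sup>2) \<partial>count_space UNIV)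
      \<le> (\<integral>\<^sup>+v. (\<Sum>w\<in>Chi T j v. ennreal ((cmod (f w))\<^sup>2)) \<partial>count_space UNIV)"
    by (intro nn_integral_mono) (simp add: sum_ennreal ennreal_leI)
  also have "\<dots> \<le> (\<integral>\<^sup>+v. ennreal ((cmod (f v))\<^sup>2) \<partial>count_space UNIV)"
    unfolding nn_integral_non_root[symmetric]
    by (intro nn_integral_mono) (auto split: split_indicator)
  also have "\<dots> < \<infinity>" using assms by (simp add: l2_iff)
  finally show ?thesis by (auto simp: l2_iff adjoint_shift_def Chi_empty)
qed

lemma DA_shift_in_l2:
  assumes "g \<in> l2 (vertices T)"
  shows "DA_shift T a j g \<in> l2 (vertices T)"
proof -
  have "(\<integral>\<^sup>+x. ennreal ((cmod (DA_shift T a j g x))\<^sup>2) \<partial>count_space UNIV)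
      = (\<integral>\<^sup>+x. ennreal ((cmod (g (par j x)))\<^sup>2 * (weight T a j x)\<^sup>2) * indicator (non_root j) x \<partial>count_space UNIV)"
    by (intro nn_integral_cong) (auto simp: DA_shift_eq norm_mult power_mult_distrib split: split_indicator)
  also have "\<dots> = (\<integral>\<^sup>+v. (\<Sum>w\<in>Chi T j v. ennreal ((cmod (g (par j w)))\<^sup>2 * (weight T a j w)\<^sup>2)) \<partial>count_space UNIV)"
    by (rule nn_integral_non_root)
  also have "\<dots> = (\<integral>\<^sup>+v. ennreal ((cmod (g v))\<^sup>2 * (\<Sum>w\<in>Chi T j v. (weight T a j w)\<^sup>2)) \<partial>count_space UNIV)"
    by (intro nn_integral_cong) (auto simp: sum_distrib_left Chi_iff intro!: arg_cong[where f = ennreal] sum.cong)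
  also have "\<dots> \<le> (\<integral>\<^sup>+v. ennreal ((cmod (g v))\<^sup>2) \<partial>count_space UNIV)"
    by (intro nn_integral_mono ennreal_leI mult_left_le sum_weight_le) auto
  also have "\<dots> < \<infinity>" using assms by (simp add: l2_iff)
  finally show ?thesis by (auto simp: l2_iff DA_shift_eq dest: non_root_vertex)
qed

text \<open>The terms are complex, so the interchange needs absolute summability, which comes from
  square summability of both functions. The double sum over vertices and their j-children is a
  single sum over \<open>non_root j\<close>, because a child determines its parent.\<close>

lemma l2_inner_DA_shift:
  assumes "g \<in> l2 (vertices T)" "f \<in> l2 (vertices T)"
  shows "l2_inner (vertices T) (DA_shift T a j g) f = l2_inner (vertices T) g (adjoint_shift j f)"
proof -
  let ?V = "vertices T" and ?h = "\<lambda>x. g (par j x) * complex_of_real (weight T a j x) * cnj (f x)"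
  have bij: "bij_betw snd (Sigma ?V (Chi T j)) (non_root j)"
    by (rule bij_betw_byWitness[where f' = "\<lambda>x. (par j x, x)"]) (auto simp: Chi_iff par_vertex)
  have "(\<lambda>x. DA_shift T a j g x * cnj (f x)) summable_on ?V"
    using l2_inner_abs_summable[OF DA_shift_in_l2[OF assms(1)] assms(2)] by (rule abs_summable_summable)
  then have "(\<lambda>x. DA_shift T a j g x * cnj (f x)) summable_on non_root j"
    by (rule summable_on_subset_banach) (auto simp: non_root_def)
  then have "?h summable_on non_root j"
    by (rule summable_on_cong[THEN iffD1, rotated]) (simp add: DA_shift_eq)
  then have summ: "(?h \<circ> snd) summable_on Sigma ?V (Chi T j)"
    using summable_on_reindex_bij_betw[OF bij, of ?h] by (simp add: comp_def)
  have "l2_inner ?V (DA_shift T a j g) f = (\<Sum>\<^sub>\<infinity>x\<in>non_root j. ?h x)"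
    unfolding l2_inner_def by (rule infsum_cong_neutral) (auto simp: DA_shift_eq dest: non_root_vertex)
  also have "\<dots> = (\<Sum>\<^sub>\<infinity>p\<in>Sigma ?V (Chi T j). (?h \<circ> snd) p)"
    using infsum_reindex_bij_betw[OF bij, of ?h] by simp
  also have "\<dots> = (\<Sum>\<^sub>\<infinity>v\<in>?V. \<Sum>\<^sub>\<infinity>x\<in>Chi T j v. (?h \<circ> snd) (v, x))"
    by (rule infsum_Sigma_banach[OF summ, symmetric])
  also have "\<dots> = (\<Sum>\<^sub>\<infinity>v\<in>?V. g v * cnj (adjoint_shift j f v))"
    by (intro infsum_cong) (auto simp: finite_Chi adjoint_shift_def sum_distrib_left Chi_iff mult_ac intro!: sum.cong)
  finally show ?thesis by (simp add: l2_inner_def)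
qed

text \<open>Turns the joint kernel into finite linear equations, one for each family of children.
  Letting \<open>v\<close> range over all functions adds nothing, as \<open>Chi T j v\<close> is
  empty off the vertices.\<close>

lemma joint_kernel_iff:
  "f \<in> joint_kernel T a \<longleftrightarrow> f \<in> l2 (vertices T) \<and> (\<forall>j v. (\<Sum>w\<in>Chi T j v. f w * complex_of_real (weight T a j w)) = 0)"
proof -
  have "l2_adjoint (vertices T) (DA_shift T a j) f = adjoint_shift j f" if "f \<in> l2 (vertices T)" for j
    using that by (intro l2_adjoint_eqI adjoint_shift_in_l2 l2_inner_DA_shift)
  then show ?thesis by (auto simp: joint_kernel_def fun_eq_iff adjoint_shift_def)
qed

lemma zero_in_joint_kernel: "(\<lambda>_. 0) \<in> joint_kernel T a"
  by (simp add: joint_kernel_iff l2_iff)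

text \<open>Later \<open>c \<beta>\<close> is the mass of a fixed Borel set under the measure at
  depth \<beta>; the bound by 1 keeps the product square summable.\<close>

lemma joint_kernel_mult_depth:
  assumes "f \<in> joint_kernel T a" "\<And>\<beta>. cmod (c \<beta>) \<le> 1"
  shows "(\<lambda>v. c (dep v) * f v) \<in> joint_kernel T a"
proof -
  have f: "f \<in> l2 (vertices T)" using assms(1) by (simp add: joint_kernel_iff)
  have "(\<integral>\<^sup>+v. ennreal ((cmod (c (dep v) * f v))\<^sup>2) \<partial>count_space UNIV)
      \<le> (\<integral>\<^sup>+v. ennreal ((cmod (f v))\<^sup>2) \<partial>count_space UNIV)"
    using assms(2) by (intro nn_integral_mono ennreal_leI power_mono) (auto simp: norm_mult intro: mult_left_le_one_le)
  also have "\<dots> < \<infinity>" using f by (simp add: l2_iff)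
  finally have "(\<lambda>v. c (dep v) * f v) \<in> l2 (vertices T)" using f by (simp add: l2_iff)
  moreover have "(\<Sum>w\<in>Chi T j v. c (dep w) * f w * complex_of_real (weight T a j w))
      = c ((dep v)(j := Suc (dep v j))) * (\<Sum>w\<in>Chi T j v. f w * complex_of_real (weight T a j w))" for j v
    by (auto simp: sum_distrib_left depth_Chi mult_ac intro!: sum.cong)
  ultimately show ?thesis using assms(1) by (simp add: joint_kernel_iff)
qed

end

section \<open>Norms in the analytic model\<close>

context multishift
begin

text \<open>The squared norm of \<open>f\<close>, weighted by the factors by which the operators \<open>S\<^sup>\<gamma>\<close> scale the
  squared norms of the basis vectors.\<close>

definition weighted_norm :: "('d \<Rightarrow> nat) \<Rightarrow> (('d \<Rightarrow> 'v) \<Rightarrow> complex) \<Rightarrow> ennreal" where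
  "weighted_norm \<gamma> f = (\<integral>\<^sup>+v. ennreal ((cmod (f v))\<^sup>2
     * (model_weight a (\<lambda>j. dep v j + \<gamma> j) / model_weight a (dep v))) \<partial>count_space UNIV)"

lemma weighted_norm_0: "weighted_norm (\<lambda>_. 0) f = (\<integral>\<^sup>+v. ennreal ((cmod (f v))\<^sup>2) \<partial>count_space UNIV)"
proof -
  have "model_weight a (dep v) \<noteq> 0" for v using model_weight_pos[of a "dep v"] by simp
  then show ?thesis by (simp add: weighted_norm_def)
qed

lemma cauchy_dual_outside: "x \<notin> vertices T \<Longrightarrow> cauchy_dual T a j f x = 0"
  using non_root_vertex by (auto simp: cauchy_dual_eq)

text \<open>Write R for \<open>model_weight a\<close>. The mass at a vertex of depth \<beta> moves
  to children of depth \<beta> + e_j and is multiplied by R(\<beta> + e_j) / R(\<beta>), which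
  cancels the denominator of the weight R(\<beta> + e_j + \<gamma>) / R(\<beta> + e_j). The free
  index \<gamma> allows the rule to be iterated.\<close>

lemma weighted_norm_cauchy_dual:
  assumes f: "\<And>v. v \<notin> vertices T \<Longrightarrow> f v = 0"
  shows "weighted_norm \<gamma> (cauchy_dual T a j f) = weighted_norm (\<gamma>(j := Suc (\<gamma> j))) f"
proof -
  let ?W = "\<lambda>\<beta>. model_weight a (\<lambda>i. \<beta> i + \<gamma> i) / model_weight a \<beta>"
  let ?q = "\<lambda>v. dual_factor (multi_abs (dep v))"
  have "weighted_norm \<gamma> (cauchy_dual T a j f)
      = (\<integral>\<^sup>+x. ennreal ((cmod (f (par j x)))\<^sup>2 * (?q (par j x))\<^sup>2 * (weight T a j x)\<^sup>2 * ?W (dep x))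
           * indicator (non_root j) x \<partial>count_space UNIV)"
    unfolding weighted_norm_def
    by (intro nn_integral_cong)
       (auto simp: cauchy_dual_eq norm_mult power_mult_distrib mult.assoc split: split_indicator)
  also have "\<dots> = (\<integral>\<^sup>+v. (\<Sum>w\<in>Chi T j v.
      ennreal ((cmod (f (par j w)))\<^sup>2 * (?q (par j w))\<^sup>2 * (weight T a j w)\<^sup>2 * ?W (dep w))) \<partial>count_space UNIV)"
    by (rule nn_integral_non_root)
  also have "\<dots> = weighted_norm (\<gamma>(j := Suc (\<gamma> j))) f"
    unfolding weighted_norm_def
  proof (intro nn_integral_cong)
    fix v
    show "(\<Sum>w\<in>Chi T j v. ennreal ((cmod (f (par j w)))\<^sup>2 * (?q (par j w))\<^sup>2 * (weight T a j w)\<^sup>2 * ?W (dep w)))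
      = ennreal ((cmod (f v))\<^sup>2 * (model_weight a (\<lambda>i. dep v i + (\<gamma>(j := Suc (\<gamma> j))) i) / model_weight a (dep v)))"
    proof (cases "v \<in> vertices T")
      case False
      then show ?thesis by (simp add: Chi_empty f)
    next
      case True
      define \<beta> where "\<beta> = dep v"
      let ?\<beta>' = "\<beta>(j := Suc (\<beta> j))"
      have pos: "model_weight a \<beta> > 0" "model_weight a ?\<beta>' > 0" "model_weight a (\<lambda>i. ?\<beta>' i + \<gamma> i) > 0"
        by (rule model_weight_pos)+
      have shift: "(\<lambda>i. \<beta> i + (\<gamma>(j := Suc (\<gamma> j))) i) = (\<lambda>i. ?\<beta>' i + \<gamma> i)" by auto
      have n: "real (multi_abs \<beta>) + real a > 0" using a_pos by simp
      have "(\<Sum>w\<in>Chi T j v. ennreal ((cmod (f (par j w)))\<^sup>2 * (?q (par j w))\<^sup>2 * (weight T a j w)\<^sup>2 * ?W (dep w)))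
          = (\<Sum>w\<in>Chi T j v. ennreal ((cmod (f v))\<^sup>2 * (?q v)\<^sup>2 * (weight T a j w)\<^sup>2 * ?W ?\<beta>'))"
        by (intro sum.cong refl) (auto simp: depth_Chi \<beta>_def, auto simp: Chi_iff)
      also have "\<dots> = ennreal ((cmod (f v))\<^sup>2 * (?q v)\<^sup>2 * (\<Sum>w\<in>Chi T j v. (weight T a j w)\<^sup>2) * ?W ?\<beta>')"
        using pos by (subst sum_ennreal) (auto simp: sum_distrib_left sum_distrib_right sum_divide_distrib less_imp_le)
      also have "(\<Sum>w\<in>Chi T j v. (weight T a j w)\<^sup>2) = (real (\<beta> j) + 1) / (real (multi_abs \<beta>) + real a)"
        by (simp add: sum_weight_power2[OF True] \<beta>_def)
      also have "(?q v)\<^sup>2 = ((real (multi_abs \<beta>) + real a) / (real (multi_abs \<beta>) + real CARD('d)))\<^sup>2"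
        by (simp add: dual_factor_def \<beta>_def)
      also have "(cmod (f v))\<^sup>2 * ((real (multi_abs \<beta>) + real a) / (real (multi_abs \<beta>) + real CARD('d)))\<^sup>2
            * ((real (\<beta> j) + 1) / (real (multi_abs \<beta>) + real a)) * ?W ?\<beta>'
          = (cmod (f v))\<^sup>2 * (((real (multi_abs \<beta>) + real a) / (real (multi_abs \<beta>) + real CARD('d)))\<^sup>2
            * ((real (\<beta> j) + 1) / (real (multi_abs \<beta>) + real a)) * ?W ?\<beta>')"
        by (simp only: mult.assoc)
      also have "((real (multi_abs \<beta>) + real a) / (real (multi_abs \<beta>) + real CARD('d)))\<^sup>2
            * ((real (\<beta> j) + 1) / (real (multi_abs \<beta>) + real a)) = model_weight a ?\<beta>' / model_weight a \<beta>"
        using n pos(1) by (simp add: model_weight_Suc[OF a_pos] power2_eq_square)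
      also have "(model_weight a ?\<beta>' / model_weight a \<beta>) * ?W ?\<beta>' = model_weight a (\<lambda>i. ?\<beta>' i + \<gamma> i) / model_weight a \<beta>"
        using pos by simp
      finally show ?thesis unfolding \<beta>_def[symmetric] shift .
    qed
  qed
  finally show ?thesis .
qed

lemma cauchy_dual_funpow_outside:
  assumes "\<And>v. v \<notin> vertices T \<Longrightarrow> f v = 0" "v \<notin> vertices T"
  shows "(cauchy_dual T a j ^^ k) f v = 0"
  using assms by (cases k) (auto simp: cauchy_dual_outside)

lemma weighted_norm_funpow:
  assumes f: "\<And>v. v \<notin> vertices T \<Longrightarrow> f v = 0"
  shows "weighted_norm \<gamma> ((cauchy_dual T a j ^^ k) f) = weighted_norm (\<gamma>(j := \<gamma> j + k)) f"
proof (induction k arbitrary: \<gamma>)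
  case (Suc k)
  have "weighted_norm \<gamma> ((cauchy_dual T a j ^^ Suc k) f)
      = weighted_norm (\<gamma>(j := Suc (\<gamma> j))) ((cauchy_dual T a j ^^ k) f)"
    using cauchy_dual_funpow_outside[OF f] by (simp add: weighted_norm_cauchy_dual)
  also have "\<dots> = weighted_norm (\<gamma>(j := \<gamma> j + Suc k)) f"
  proof -
    have "(\<gamma>(j := Suc (\<gamma> j)))(j := (\<gamma>(j := Suc (\<gamma> j))) j + k) = \<gamma>(j := \<gamma> j + Suc k)" by auto
    then show ?thesis by (simp only: Suc.IH)
  qed
  finally show ?case .
qed simp

end

section \<open>Powers of commuting tuples\<close>

lemma funpow_commute_left:
  assumes "f \<circ> g = g \<circ> f"
  shows "f \<circ> g ^^ n = g ^^ n \<circ> f"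
proof
  fix x
  have fg: "f (g y) = g (f y)" for y using assms by (simp add: fun_eq_iff)
  show "(f \<circ> g ^^ n) x = (g ^^ n \<circ> f) x"
    by (induction n) (simp_all add: fg)
qed

lemma funpow_commute:
  assumes "f \<circ> g = g \<circ> f"
  shows "f ^^ m \<circ> g ^^ n = g ^^ n \<circ> f ^^ m"
  using funpow_commute_left[OF funpow_commute_left[OF assms, symmetric], symmetric] .

lemma comp_fun_commute_tuple:
  assumes "\<And>i j. S i \<circ> S j = S j \<circ> S i"
  shows "comp_fun_commute (\<lambda>j A. (S j ^^ \<alpha> j) \<circ> A)"
proof
  fix i j
  have "S j ^^ \<alpha> j \<circ> S i ^^ \<alpha> i = S i ^^ \<alpha> i \<circ> S j ^^ \<alpha> j"
    by (rule funpow_commute[OF assms])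
  then show "(\<lambda>A. (S j ^^ \<alpha> j) \<circ> A) \<circ> (\<lambda>A. (S i ^^ \<alpha> i) \<circ> A) = (\<lambda>A. (S i ^^ \<alpha> i) \<circ> A) \<circ> (\<lambda>A. (S j ^^ \<alpha> j) \<circ> A)"
    by (simp add: fun_eq_iff)
qed

text \<open>Induction on the set of indices already folded: the accompanying multi-index is \<alpha>
  cut off to that set, so a new index always meets \<open>\<beta> j = 0\<close>. It serves both the
  Cauchy dual and the multiplications \<open>mult_z\<close>.\<close>

lemma tuple_power_induct:
  fixes S :: "'d::finite \<Rightarrow> 'f \<Rightarrow> 'f"
  assumes "\<And>i j. S i \<circ> S j = S j \<circ> S i"
    and "P (\<lambda>_. 0) f"
    and "\<And>\<beta> g j. P \<beta> g \<Longrightarrow> \<beta> j = 0 \<Longrightarrow> P (\<beta>(j := \<alpha> j)) ((S j ^^ \<alpha> j) g)"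
  shows "P \<alpha> (tuple_power S \<alpha> f)"
proof -
  interpret comp_fun_commute "\<lambda>j A. (S j ^^ \<alpha> j) \<circ> A" by (rule comp_fun_commute_tuple[OF assms(1)])
  have "P (\<lambda>j. if j \<in> F then \<alpha> j else 0) (Finite_Set.fold (\<lambda>j A. (S j ^^ \<alpha> j) \<circ> A) id F f)" if "finite F" for F
    using that
  proof induction
    case empty
    then show ?case using assms(2) by simp
  next
    case (insert j F)
    have "(\<lambda>i. if i \<in> insert j F then \<alpha> i else 0) = (\<lambda>i. if i \<in> F then \<alpha> i else 0)(j := \<alpha> j)" by auto
    moreover have "Finite_Set.fold (\<lambda>j A. (S j ^^ \<alpha> j) \<circ> A) id (insert j F) f
        = (S j ^^ \<alpha> j) (Finite_Set.fold (\<lambda>j A. (S j ^^ \<alpha> j) \<circ> A) id F f)"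
      by (subst fold_insert[OF insert.hyps]) simp
    ultimately show ?case
      using assms(3)[OF insert.IH, of j] insert.hyps(2) by (simp only: if_False simp_thms)
  qed
  from this[of UNIV] show ?thesis by (simp add: tuple_power_def)
qed

lemma mult_z_commute: "mult_z i \<circ> mult_z j = mult_z j \<circ> mult_z i"
  by (cases "i = j") (auto simp: mult_z_def fun_eq_iff fun_upd_twist)

lemma mult_z_funpow_single:
  "(mult_z j ^^ k) (\<lambda>\<gamma>. if \<gamma> = \<beta> then f else (\<lambda>_. 0)) = (\<lambda>\<gamma>. if \<gamma> = \<beta>(j := \<beta> j + k) then f else (\<lambda>_. 0))"
proof (induction k)
  case (Suc k)
  have "(mult_z j ^^ Suc k) (\<lambda>\<gamma>. if \<gamma> = \<beta> then f else (\<lambda>_. 0))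
      = mult_z j (\<lambda>\<gamma>. if \<gamma> = \<beta>(j := \<beta> j + k) then f else (\<lambda>_. 0))"
    by (simp only: funpow.simps comp_apply Suc.IH)
  also have "\<dots> = (\<lambda>\<gamma>. if \<gamma> = \<beta>(j := \<beta> j + Suc k) then f else (\<lambda>_. 0))"
  proof
    fix \<gamma>
    have "\<gamma> j \<noteq> 0 \<and> \<gamma>(j := \<gamma> j - 1) = \<beta>(j := \<beta> j + k) \<longleftrightarrow> \<gamma> = \<beta>(j := \<beta> j + Suc k)"
      by (auto simp: fun_eq_iff)
    then show "mult_z j (\<lambda>\<gamma>. if \<gamma> = \<beta>(j := \<beta> j + k) then f else (\<lambda>_. 0)) \<gamma>
        = (if \<gamma> = \<beta>(j := \<beta> j + Suc k) then f else (\<lambda>_. 0))"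
      unfolding mult_z_def by (cases "\<gamma> j = 0") simp_all
  qed
  finally show ?case .
qed simp

text \<open>With a single possibly nonzero coefficient, the sum in the model norm reduces to one
  term.\<close>

lemma monomial_series_eq: "monomial_series \<alpha> f = (\<lambda>\<gamma>. if \<gamma> = \<alpha> then f else (\<lambda>_. 0))"
  unfolding monomial_series_def
proof (rule tuple_power_induct[where P = "\<lambda>\<beta> g. g = (\<lambda>\<gamma>. if \<gamma> = \<beta> then f else (\<lambda>_. 0))"])
  show "mult_z i \<circ> mult_z j = mult_z j \<circ> mult_z i" for i j :: 'a by (rule mult_z_commute)
qed (simp_all add: const_series_def mult_z_funpow_single)

section \<open>Norms of monomials\<close>

context multishift
begin

text \<open>Vanishing off the vertices is carried along because the rule for a single operator
  requires it, and \<gamma> is quantified inside the induction because each step shifts it.\<close>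

lemma weighted_norm_tuple_power:
  assumes "\<And>v. v \<notin> vertices T \<Longrightarrow> f v = 0"
  shows "(\<forall>v. v \<notin> vertices T \<longrightarrow> tuple_power (cauchy_dual T a) \<alpha> f v = 0) \<and>
     (\<forall>\<gamma>. weighted_norm \<gamma> (tuple_power (cauchy_dual T a) \<alpha> f) = weighted_norm (\<lambda>j. \<gamma> j + \<alpha> j) f)"
proof (rule tuple_power_induct[where P = "\<lambda>\<beta> g. (\<forall>v. v \<notin> vertices T \<longrightarrow> g v = 0) \<and>
     (\<forall>\<gamma>. weighted_norm \<gamma> g = weighted_norm (\<lambda>j. \<gamma> j + \<beta> j) f)"])
  fix \<beta> g j
  assume g: "(\<forall>v. v \<notin> vertices T \<longrightarrow> g v = 0) \<and> (\<forall>\<gamma>. weighted_norm \<gamma> g = weighted_norm (\<lambda>i. \<gamma> i + \<beta> i) f)"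
    and j: "\<beta> j = (0::nat)"
  have "weighted_norm \<gamma> ((cauchy_dual T a j ^^ \<alpha> j) g) = weighted_norm (\<lambda>i. \<gamma> i + (\<beta>(j := \<alpha> j)) i) f" for \<gamma>
  proof -
    have "(\<lambda>i. (\<gamma>(j := \<gamma> j + \<alpha> j)) i + \<beta> i) = (\<lambda>i. \<gamma> i + (\<beta>(j := \<alpha> j)) i)" using j by auto
    with g show ?thesis by (simp add: weighted_norm_funpow)
  qed
  with g show "(\<forall>v. v \<notin> vertices T \<longrightarrow> (cauchy_dual T a j ^^ \<alpha> j) g v = 0) \<and>
     (\<forall>\<gamma>. weighted_norm \<gamma> ((cauchy_dual T a j ^^ \<alpha> j) g) = weighted_norm (\<lambda>i. \<gamma> i + (\<beta>(j := \<alpha> j)) i) f)"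
    by (simp add: cauchy_dual_funpow_outside)
next
  show "cauchy_dual T a i \<circ> cauchy_dual T a j = cauchy_dual T a j \<circ> cauchy_dual T a i" for i j
    by (rule cauchy_dual_commute)
qed (use assms in auto)

lemma nn_integral_tuple_power:
  assumes "\<And>v. v \<notin> vertices T \<Longrightarrow> f v = 0"
  shows "(\<integral>\<^sup>+v. ennreal ((cmod (tuple_power (cauchy_dual T a) \<alpha> f v))\<^sup>2) \<partial>count_space UNIV) = weighted_norm \<alpha> f"
  unfolding weighted_norm_0[symmetric] using weighted_norm_tuple_power[OF assms, where \<alpha> = \<alpha>] by simp

text \<open>The norm is an unordered sum and would be 0 on divergence, so finiteness of
  \<open>weighted_norm\<close> has to enter before passing back to real numbers.\<close>

lemma norm_tuple_power:
  assumes f: "f \<in> l2 (vertices T)" and fin: "weighted_norm \<alpha> f < \<infinity>"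
  shows "ennreal ((l2_norm (vertices T) (tuple_power (cauchy_dual T a) \<alpha> f))\<^sup>2) = weighted_norm \<alpha> f"
proof -
  have z: "f v = 0" if "v \<notin> vertices T" for v using f that by (simp add: l2_def)
  have "tuple_power (cauchy_dual T a) \<alpha> f \<in> l2 (vertices T)"
    using weighted_norm_tuple_power[OF z, where \<alpha> = \<alpha>] fin by (simp add: l2_iff nn_integral_tuple_power[OF z])
  then show ?thesis by (simp add: ennreal_l2_norm_power2 nn_integral_tuple_power[OF z])
qed

lemma norm_tuple_power_0: "l2_norm (vertices T) (tuple_power (cauchy_dual T a) \<alpha> (\<lambda>_. 0)) = 0"
proof -
  have "weighted_norm \<alpha> (\<lambda>_. 0) = 0" by (simp add: weighted_norm_def)
  with norm_tuple_power[of "\<lambda>_. 0" \<alpha>] show ?thesis by (simp add: l2_iff)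
qed

lemma monomial_norms:
  "(\<lambda>\<gamma>. (l2_norm (vertices T) (tuple_power (cauchy_dual T a) \<gamma> (monomial_series \<alpha> f \<gamma>)))\<^sup>2)
    = (\<lambda>\<gamma>. if \<gamma> = \<alpha> then (l2_norm (vertices T) (tuple_power (cauchy_dual T a) \<alpha> f))\<^sup>2 else 0)"
  by (auto simp: monomial_series_eq norm_tuple_power_0)

lemma monomial_in_model_space:
  assumes "f \<in> joint_kernel T a"
  shows "monomial_series \<alpha> f \<in> model_space T a"
proof -
  let ?g = "\<lambda>\<gamma>. if \<gamma> = \<alpha> then (l2_norm (vertices T) (tuple_power (cauchy_dual T a) \<alpha> f))\<^sup>2 else 0"
  have "?g summable_on UNIV \<longleftrightarrow> ?g summable_on {\<alpha>}"
    by (rule summable_on_cong_neutral) auto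
  then show ?thesis
    using assms zero_in_joint_kernel unfolding model_space_def mem_Collect_eq monomial_norms
    by (simp add: monomial_series_eq)
qed

lemma model_norm_monomial:
  assumes "f \<in> l2 (vertices T)" "weighted_norm \<alpha> f < \<infinity>"
  shows "ennreal ((model_norm T a (monomial_series \<alpha> f))\<^sup>2) = weighted_norm \<alpha> f"
proof -
  let ?n = "(l2_norm (vertices T) (tuple_power (cauchy_dual T a) \<alpha> f))\<^sup>2"
  have "(\<Sum>\<^sub>\<infinity>\<gamma>. if \<gamma> = \<alpha> then ?n else 0) = (\<Sum>\<^sub>\<infinity>\<gamma>\<in>{\<alpha>}. if \<gamma> = \<alpha> then ?n else 0)"
    by (rule infsum_cong_neutral) auto
  then show ?thesis
    using norm_tuple_power[OF assms] by (simp add: model_norm_def monomial_norms)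
qed

end

section \<open>The representing measure\<close>

text \<open>Countable additivity under a sum over vertices is an interchange of two sums. The masses
  of the disjoint pieces add up to at most 1, so summing over the pieces first leaves a family
  dominated by the summable norms of \<open>k\<close>.\<close>

lemma infsum_measure_sums:
  fixes k :: "'x \<Rightarrow> complex"
  assumes M: "\<And>v. prob_space (M v)" "\<And>v. range A \<subseteq> sets (M v)" and dis: "disjoint_family A"
    and k: "(\<lambda>v. norm (k v)) summable_on V"
  shows "(\<lambda>n. \<Sum>\<^sub>\<infinity>v\<in>V. complex_of_real (measure (M v) (A n)) * k v)
    sums (\<Sum>\<^sub>\<infinity>v\<in>V. complex_of_real (measure (M v) (\<Union>n. A n)) * k v)"
proof -
  define F where "F = (\<lambda>(v, n). complex_of_real (measure (M v) (A n)) * k v)"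
  let ?U = "\<lambda>v. measure (M v) (\<Union>n. A n)"
  have meas: "(\<lambda>n. measure (M v) (A n)) sums ?U v" for v
  proof -
    interpret prob_space "M v" by (rule M)
    show ?thesis by (rule finite_measure_UNION[OF M(2) dis])
  qed
  have le: "?U v \<le> 1" for v
  proof -
    interpret prob_space "M v" by (rule M)
    show ?thesis by (rule prob_le_1)
  qed
  have norm_sum: "(\<lambda>n. norm (F (v, n))) sums (?U v * norm (k v))" for v
    using sums_mult2[OF meas, where c = "norm (k v)"] by (simp add: F_def norm_mult)
  have "(\<lambda>p. norm (F p)) summable_on V \<times> UNIV"
  proof (rule summable_on_SigmaI)
    show "((\<lambda>n. norm (F (v, n))) has_sum (?U v * norm (k v))) UNIV" for v
      by (rule sums_nonneg_imp_has_sum[OF norm_sum]) simp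
    show "(\<lambda>v. ?U v * norm (k v)) summable_on V"
      by (rule summable_on_comparison_test[OF k]) (auto simp: le mult_left_le_one_le)
  qed simp
  then have summ: "F summable_on V \<times> UNIV" by (rule abs_summable_summable)
  have inner: "((\<lambda>n. F (v, n)) has_sum (complex_of_real (?U v) * k v)) UNIV" for v
  proof (rule norm_summable_imp_has_sum)
    show "summable (\<lambda>n. norm (F (v, n)))" using norm_sum by (rule sums_summable)
    show "(\<lambda>n. F (v, n)) sums (complex_of_real (?U v) * k v)"
      unfolding F_def prod.case by (intro sums_mult2 sums_of_real meas)
  qed
  have "(F has_sum infsum F (V \<times> UNIV)) (V \<times> UNIV)" using summ by (rule has_sum_infsum)
  moreover have "((\<lambda>v. complex_of_real (?U v) * k v) has_sum infsum F (V \<times> UNIV)) V"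
    by (rule has_sum_SigmaD[OF calculation]) (rule inner)
  then have "infsum F (V \<times> UNIV) = (\<Sum>\<^sub>\<infinity>v\<in>V. complex_of_real (?U v) * k v)"
    by (simp add: infsumI)
  ultimately have "(F has_sum (\<Sum>\<^sub>\<infinity>v\<in>V. complex_of_real (?U v) * k v)) (V \<times> UNIV)" by simp
  then have total: "((\<lambda>(n, v). F (v, n)) has_sum (\<Sum>\<^sub>\<infinity>v\<in>V. complex_of_real (?U v) * k v)) (UNIV \<times> V)"
    by (subst (asm) has_sum_swap)
  have "((\<lambda>n. \<Sum>\<^sub>\<infinity>v\<in>V. F (v, n)) has_sum (\<Sum>\<^sub>\<infinity>v\<in>V. complex_of_real (?U v) * k v)) UNIV"
  proof (rule has_sum_SigmaD[OF total])
    fix n :: nat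
    have "(\<lambda>v. norm (F (v, n))) summable_on V"
    proof (rule summable_on_comparison_test[OF k])
      fix v
      interpret prob_space "M v" by (rule M)
      show "norm (F (v, n)) \<le> norm (k v)" by (simp add: F_def norm_mult mult_left_le_one_le)
    qed simp
    then show "((\<lambda>v. case (n, v) of (n, v) \<Rightarrow> F (v, n)) has_sum (\<Sum>\<^sub>\<infinity>v\<in>V. F (v, n))) V"
      by (simp add: abs_summable_summable)
  qed
  then show ?thesis unfolding F_def by (intro has_sum_imp_sums) simp
qed

section \<open>The operator-valued measure\<close>

locale multishift_model = multishift T a
  for T :: "'d::finite \<Rightarrow> 'v pair_pre_digraph" and a :: nat +
  assumes a_less: "a < CARD('d)"
begin

abbreviation vertex_measure :: "('d \<Rightarrow> 'v) \<Rightarrow> (real \<times> (complex ^ 'd)) measure" where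
  "vertex_measure v \<equiv> block_measure a (dep v)"

definition op_measure ::
    "(real \<times> (complex ^ 'd)) set \<Rightarrow> (('d \<Rightarrow> 'v) \<Rightarrow> complex) \<Rightarrow> (('d \<Rightarrow> 'v) \<Rightarrow> complex)" where
  "op_measure A f = (\<lambda>v. complex_of_real (measure (vertex_measure v) A) * f v)"

lemma prob_vertex_measure: "prob_space (block_measure a \<beta> :: (real \<times> (complex ^ 'd)) measure)"
  by (rule prob_space_block_measure[OF a_pos a_less])

lemma measure_le_1: "measure (block_measure a (\<beta> :: 'd \<Rightarrow> nat)) A \<le> 1"
  using prob_vertex_measure by (rule prob_space.prob_le_1)

lemma joint_kernel_l2: "f \<in> joint_kernel T a \<Longrightarrow> f \<in> l2 (vertices T)"
  by (simp add: joint_kernel_iff)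

lemma op_measure_in_joint_kernel:
  assumes "f \<in> joint_kernel T a"
  shows "op_measure A f \<in> joint_kernel T a"
  unfolding op_measure_def
  by (rule joint_kernel_mult_depth[OF assms, where c = "\<lambda>\<beta>. complex_of_real (measure (block_measure a \<beta>) A)"])
     (simp add: measure_le_1)

lemma l2_inner_op_measure:
  assumes "f \<in> l2 (vertices T)"
  shows "l2_inner (vertices T) (op_measure A f) f
    = complex_of_real (\<Sum>\<^sub>\<infinity>v\<in>vertices T. measure (vertex_measure v) A * (cmod (f v))\<^sup>2)"
    and "(\<lambda>v. measure (vertex_measure v) A * (cmod (f v))\<^sup>2) summable_on vertices T"
proof -
  show summ: "(\<lambda>v. measure (vertex_measure v) A * (cmod (f v))\<^sup>2) summable_on vertices T"
    by (rule summable_on_comparison_test[of "\<lambda>v. (cmod (f v))\<^sup>2"])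
       (use assms in \<open>auto simp: l2_def measure_le_1 mult_left_le_one_le\<close>)
  have "l2_inner (vertices T) (op_measure A f) f
      = (\<Sum>\<^sub>\<infinity>v\<in>vertices T. complex_of_real (measure (vertex_measure v) A * (cmod (f v))\<^sup>2))"
    unfolding l2_inner_def op_measure_def
    by (intro infsum_cong) (simp add: complex_norm_square mult.assoc del: of_real_power)
  also have "\<dots> = complex_of_real (\<Sum>\<^sub>\<infinity>v\<in>vertices T. measure (vertex_measure v) A * (cmod (f v))\<^sup>2)"
    by (rule infsumI[OF has_sum_of_real[OF has_sum_infsum[OF summ]]])
  finally show "l2_inner (vertices T) (op_measure A f) f
    = complex_of_real (\<Sum>\<^sub>\<infinity>v\<in>vertices T. measure (vertex_measure v) A * (cmod (f v))\<^sup>2)" .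
qed

text \<open>Each value is multiplication by a function with values in [0,1], hence a positive
  contraction; only countable additivity needs an argument.\<close>

lemma operator_measure_op_measure: "operator_measure (vertices T) (joint_kernel T a) op_measure"
  unfolding operator_measure_def
proof (intro conjI ballI allI impI)
  fix A :: "(real \<times> (complex ^ 'd)) set" and f
  assume f: "f \<in> joint_kernel T a"
  show "op_measure A f \<in> joint_kernel T a" by (rule op_measure_in_joint_kernel[OF f])
  show "Im (l2_inner (vertices T) (op_measure A f) f) = 0" "0 \<le> Re (l2_inner (vertices T) (op_measure A f) f)"
    using l2_inner_op_measure[OF joint_kernel_l2[OF f], of A] by (auto intro!: infsum_nonneg)
  show "op_measure A (\<lambda>v. c * f v) = (\<lambda>v. c * op_measure A f v)" for c
    by (simp add: op_measure_def mult_ac)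
  show "op_measure A (\<lambda>v. f v + g v) = (\<lambda>v. op_measure A f v + op_measure A g v)" for g
    by (simp add: op_measure_def algebra_simps)
next
  fix A :: "(real \<times> (complex ^ 'd)) set"
  have "l2_norm (vertices T) (op_measure A f) \<le> 1 * l2_norm (vertices T) f" if f: "f \<in> joint_kernel T a" for f
  proof -
    have "(\<Sum>\<^sub>\<infinity>v\<in>vertices T. (cmod (op_measure A f v))\<^sup>2) \<le> (\<Sum>\<^sub>\<infinity>v\<in>vertices T. (cmod (f v))\<^sup>2)"
    proof (rule infsum_mono)
      show "(\<lambda>v. (cmod (op_measure A f v))\<^sup>2) summable_on vertices T" "(\<lambda>v. (cmod (f v))\<^sup>2) summable_on vertices T"
        using joint_kernel_l2[OF f] joint_kernel_l2[OF op_measure_in_joint_kernel[OF f]] by (simp_all add: l2_def)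
    qed (auto simp: op_measure_def norm_mult measure_le_1 intro!: power_mono mult_left_le_one_le)
    then show ?thesis by (simp add: l2_norm_def)
  qed
  then show "\<exists>C. \<forall>f\<in>joint_kernel T a. l2_norm (vertices T) (op_measure A f) \<le> C * l2_norm (vertices T) f" by blast
next
  show "op_measure {} f = (\<lambda>_. 0)" for f by (simp add: op_measure_def)
next
  fix A :: "nat \<Rightarrow> (real \<times> (complex ^ 'd)) set" and f g
  assume A: "range A \<subseteq> sets borel" "disjoint_family A" and "f \<in> joint_kernel T a" "g \<in> joint_kernel T a"
  then have "(\<lambda>v. norm (f v * cnj (g v))) summable_on vertices T"
    by (intro l2_inner_abs_summable joint_kernel_l2)
  with A have "(\<lambda>n. \<Sum>\<^sub>\<infinity>v\<in>vertices T. complex_of_real (measure (vertex_measure v) (A n)) * (f v * cnj (g v)))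
    sums (\<Sum>\<^sub>\<infinity>v\<in>vertices T. complex_of_real (measure (vertex_measure v) (\<Union>n. A n)) * (f v * cnj (g v)))"
    by (intro infsum_measure_sums) (auto simp: prob_vertex_measure)
  then show "(\<lambda>n. l2_inner (vertices T) (op_measure (A n) f) g) sums l2_inner (vertices T) (op_measure (\<Union>n. A n) f) g"
    by (simp add: l2_inner_def op_measure_def mult.assoc)
qed

lemma op_measure_supported:
  "operator_measure_supported (joint_kernel T a) op_measure ({0..1} \<times> sphere 0 1)"
  unfolding operator_measure_supported_def
proof (intro ballI impI)
  fix A :: "(real \<times> (complex ^ 'd)) set" and f :: "('d \<Rightarrow> 'v) \<Rightarrow> complex"
  assume A: "A \<in> sets borel" "A \<inter> {0..1} \<times> sphere 0 1 = {}"
  have "measure (block_measure a \<beta>) A = 0" for \<beta> :: "'d \<Rightarrow> nat"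
  proof -
    have "AE p in block_measure a \<beta>. p \<notin> A"
      using AE_block_measure[OF a_pos a_less, of \<beta>] by eventually_elim (use A(2) in auto)
    then have "emeasure (block_measure a \<beta>) {p \<in> space (block_measure a \<beta>). p \<in> A} = 0"
      by (intro emeasure_eq_0_AE) simp
    then show ?thesis by (simp add: measure_def)
  qed
  then show "op_measure A f = (\<lambda>_. 0)" by (simp add: op_measure_def)
qed

text \<open>The scalar measure \<open>\<langle>d\<mu> f, f\<rangle>\<close> is the mixture of the measures \<open>vertex_measure v\<close> with weights
  \<open>\<bar>f v\<bar>\<^sup>2\<close>.\<close>

lemma nn_integral_quadratic_measure:
  assumes f: "f \<in> l2 (vertices T)" and F: "F \<in> borel_measurable borel"
  shows "(\<integral>\<^sup>+p. F p \<partial>quadratic_measure (vertices T) op_measure f)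
      = (\<integral>\<^sup>+v. ennreal ((cmod (f v))\<^sup>2) * (\<integral>\<^sup>+p. F p \<partial>vertex_measure v) \<partial>count_space UNIV)"
proof -
  let ?D = "density (count_space UNIV) (\<lambda>v. ennreal ((cmod (f v))\<^sup>2))"
  \<comment> \<open>The mixture as a \<open>bind\<close>: weights |f v|^2 on the vertices, followed
    by the kernel \<open>vertex_measure\<close>, whose measurability is automatic on a discrete
    space.\<close>
  let ?B = "?D \<bind> vertex_measure"
  have meas: "vertex_measure \<in> measurable ?D (subprob_algebra borel)"
    using prob_space_imp_subprob_space[OF prob_vertex_measure]
    by (simp add: measurable_density_eq2 space_subprob_algebra)
  have ne: "space ?D \<noteq> {}" by simp
  have sets: "sets ?B = sets borel"
    by (rule sets_bind[OF _ ne]) simp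
  then have space: "space ?B = UNIV" by (metis sets_eq_imp_space_eq space_borel)
  have emeas: "emeasure ?B A = ennreal (Re (l2_inner (vertices T) (op_measure A f) f))"
    if A: "A \<in> sets borel" for A
  proof -
    have "emeasure ?B A = (\<integral>\<^sup>+v. emeasure (vertex_measure v) A \<partial>?D)"
      by (rule emeasure_bind[OF ne meas A])
    also have "\<dots> = (\<integral>\<^sup>+v. ennreal (measure (vertex_measure v) A * (cmod (f v))\<^sup>2) \<partial>count_space UNIV)"
    proof -
      have "emeasure (vertex_measure v) A = ennreal (measure (vertex_measure v) A)" for v
        using prob_vertex_measure[of "dep v"] by (simp add: finite_measure.emeasure_eq_measure prob_space_def)
      then show ?thesis
        by (simp add: nn_integral_density mult.commute flip: ennreal_mult)
    qed
    also have "\<dots> = (\<integral>\<^sup>+v. ennreal (measure (vertex_measure v) A * (cmod (f v))\<^sup>2) \<partial>count_space (vertices T))"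
      using f by (intro nn_integral_count_space_extend) (simp add: l2_def)
    also have "\<dots> = ennreal (\<Sum>\<^sub>\<infinity>v\<in>vertices T. measure (vertex_measure v) A * (cmod (f v))\<^sup>2)"
      by (rule nn_integral_count_space_summable[OF _ l2_inner_op_measure(2)[OF f]]) simp
    finally show ?thesis by (simp add: l2_inner_op_measure(1)[OF f])
  qed
  \<comment> \<open>\<open>measure_of\<close> yields the zero measure for a set function that is not
    countably additive; agreement with the genuine measure \<open>?B\<close> on all Borel sets
    excludes this.\<close>
  have "quadratic_measure (vertices T) op_measure f = measure_of (space ?B) (sets ?B) (emeasure ?B)"
    unfolding quadratic_measure_def space sets
    by (rule measure_of_eq) (auto simp: emeas sets.sigma_sets_eq[of borel, simplified])
  then have eq: "quadratic_measure (vertices T) op_measure f = ?B"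
    by (simp only: measure_of_of_measure)
  show "(\<integral>\<^sup>+p. F p \<partial>quadratic_measure (vertices T) op_measure f)
      = (\<integral>\<^sup>+v. ennreal ((cmod (f v))\<^sup>2) * (\<integral>\<^sup>+p. F p \<partial>vertex_measure v) \<partial>count_space UNIV)"
    unfolding eq nn_integral_bind[OF F meas] by (simp add: nn_integral_density)
qed

text \<open>Both sides are sums over the vertices, and \<open>block_moment\<close> matches them term
  by term.\<close>

lemma weighted_norm_eq_integral:
  assumes f: "f \<in> l2 (vertices T)"
  shows "weighted_norm \<alpha> f = (\<integral>\<^sup>+p\<in>{0..1} \<times> sphere 0 1.
      ennreal (fst p ^ multi_abs \<alpha> * (cmod (zpow (snd p) \<alpha>))\<^sup>2) \<partial>quadratic_measure (vertices T) op_measure f)"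
proof -
  have [measurable]: "{0..1::real} \<times> sphere (0 :: complex ^ 'd) 1 \<in> sets borel"
    by (intro borel_closed closed_Times) auto
  have [measurable]: "(\<lambda>p :: real \<times> (complex ^ 'd). ennreal (fst p ^ multi_abs \<alpha> * (cmod (zpow (snd p) \<alpha>))\<^sup>2)) \<in> borel_measurable borel"
    unfolding borel_prod[symmetric] by measurable
  have "0 \<le> model_weight a \<beta>" for \<beta> :: "'d \<Rightarrow> nat" using model_weight_pos[of a \<beta>] by simp
  then show ?thesis
    by (subst nn_integral_quadratic_measure[OF f])
       (simp_all add: weighted_norm_def block_moment[OF a_pos a_less] flip: ennreal_mult)
qed

text \<open>Each factor in \<open>weighted_norm\<close> is a moment, the integral of a function
  bounded by 1 against a probability measure, so it is at most 1 without any estimate of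
  factorials.\<close>

lemma weighted_norm_finite:
  assumes f: "f \<in> l2 (vertices T)"
  shows "weighted_norm \<alpha> f < \<infinity>"
proof -
  have "model_weight a (\<lambda>j. \<beta> j + \<alpha> j) / model_weight a \<beta> \<le> 1" for \<beta> :: "'d \<Rightarrow> nat"
  proof -
    interpret prob_space "block_measure a \<beta>" by (rule prob_vertex_measure)
    have "ennreal (model_weight a (\<lambda>j. \<beta> j + \<alpha> j) / model_weight a \<beta>) \<le> (\<integral>\<^sup>+p. 1 \<partial>block_measure a \<beta>)"
      unfolding block_moment[OF a_pos a_less, symmetric]
      by (intro nn_integral_mono)
         (auto split: split_indicator intro!: mult_le_one power_le_one cmod_zpow_le)
    then show ?thesis using emeasure_space_1 by simp
  qed
  then have "weighted_norm \<alpha> f \<le> (\<integral>\<^sup>+v. ennreal ((cmod (f v))\<^sup>2) \<partial>count_space UNIV)"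
    unfolding weighted_norm_def by (intro nn_integral_mono ennreal_leI mult_left_le) auto
  also have "\<dots> < \<infinity>" using f by (simp add: l2_iff)
  finally show ?thesis .
qed

section \<open>Sibling classes, blocks and the representing measure\<close>

lemma depth_Sib_set:
  assumes "u \<in> Phi T F" "v \<in> Sib_set T F u"
  shows "dep v = dep u"
proof
  fix j
  show "dep v j = dep u j"
  proof (cases "j \<in> F")
    case True
    then have "(parent (T j) (u j), v j) \<in> parcs (T j)" "(parent (T j) (u j), u j) \<in> parcs (T j)"
      using assms parent_arc[of u j]
      by (auto simp: Sib_set_def siblings_def children_def Phi_def non_root_def)
    then show ?thesis by (simp add: prod_depth_def tree.depth_arc)
  next
    case False
    then show ?thesis using assms by (simp add: Sib_set_def prod_depth_def)
  qed
qed

text \<open>The operator uses the depth of the point \<open>v\<close>, the claim that of the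
  representative \<open>u\<close>. The two can differ only off \<open>Sib_set T F u\<close>, where
  the block vanishes.\<close>

lemma op_measure_block_sum:
  assumes "\<And>F. \<Omega> F \<subseteq> Phi T F" "\<And>F u. u \<in> \<Omega> F \<Longrightarrow> g F u \<in> kernel_block T a u F"
  shows "op_measure A (block_sum \<Omega> g)
    = block_sum \<Omega> (\<lambda>F u v. complex_of_real (measure (vertex_measure u) A) * g F u v)"
proof
  fix v
  have "op_measure A (block_sum \<Omega> g) v
      = (\<Sum>F\<in>UNIV. \<Sum>\<^sub>\<infinity>u\<in>\<Omega> F. complex_of_real (measure (vertex_measure v) A) * g F u v)"
    by (simp add: op_measure_def block_sum_def sum_distrib_left infsum_cmult_right')
  also have "\<dots> = (\<Sum>F\<in>UNIV. \<Sum>\<^sub>\<infinity>u\<in>\<Omega> F. complex_of_real (measure (vertex_measure u) A) * g F u v)"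
  proof (intro sum.cong infsum_cong refl)
    fix F u assume u: "u \<in> \<Omega> F"
    show "complex_of_real (measure (vertex_measure v) A) * g F u v
      = complex_of_real (measure (vertex_measure u) A) * g F u v"
    proof (cases "v \<in> Sib_set T F u")
      case True
      then show ?thesis using depth_Sib_set assms(1) u by (metis subsetD)
    next
      case False
      then have "g F u v = 0" using assms(2)[OF u] by (simp add: kernel_block_def l2_def)
      then show ?thesis by simp
    qed
  qed
  finally show "op_measure A (block_sum \<Omega> g) v
    = block_sum \<Omega> (\<lambda>F u v. complex_of_real (measure (vertex_measure u) A) * g F u v) v"
    by (simp add: block_sum_def)
qed

lemma radial_measure_eq: "radial_measure T a u = radial CARD('d) a (multi_abs (dep u))"
  by (simp add: radial_measure_def radial_def)

lemma spherical_measure_eq: "spherical_measure T u = spherical (dep u)"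
  by (simp add: spherical_measure_def spherical_def)

lemma representing_measure:
  assumes "class_representatives T \<Omega>"
  shows "representing_measure T a \<Omega> (radial_measure T a) (spherical_measure T)"
proof -
  have prod: "radial_measure T a u \<Otimes>\<^sub>M spherical_measure T u = vertex_measure u" for u
    by (simp add: radial_measure_eq spherical_measure_eq block_measure_def)
  have prob: "prob_space (radial_measure T a u)" "prob_space (spherical_measure T u)" for u
    by (simp_all add: radial_measure_eq spherical_measure_eq prob_space_radial[OF a_pos a_less] prob_space_spherical)
  then have fin: "finite_measure (radial_measure T a u)" "finite_measure (spherical_measure T u)" for u
    by (simp_all add: prob_space_def)
  have \<Omega>: "\<Omega> F \<subseteq> Phi T F" for F using assms by (simp add: class_representatives_def)
  have "\<exists>\<mu>. operator_measure (vertices T) (joint_kernel T a) \<mu> \<and>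
        operator_measure_supported (joint_kernel T a) \<mu> ({0..1} \<times> sphere 0 1) \<and>
        (\<forall>f\<in>joint_kernel T a. \<forall>\<alpha>.
           monomial_series \<alpha> f \<in> model_space T a \<and>
           ennreal ((model_norm T a (monomial_series \<alpha> f))\<^sup>2) =
             (\<integral>\<^sup>+ p \<in> {0..1} \<times> sphere 0 1.
                ennreal (fst p ^ multi_abs \<alpha> * (cmod (zpow (snd p) \<alpha>))\<^sup>2)
              \<partial>quadratic_measure (vertices T) \<mu> f)) \<and>
        (\<forall>A\<in>sets borel. \<forall>g. (\<forall>F. \<forall>u\<in>\<Omega> F. g F u \<in> kernel_block T a u F) \<longrightarrow>
           \<mu> A (block_sum \<Omega> g) =
             block_sum \<Omega> (\<lambda>F u v. complex_of_real (measure (radial_measure T a u \<Otimes>\<^sub>M spherical_measure T u) A) * g F u v)) \<and>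
        prob_space (radial_measure T a (prod_root T)) \<and> prob_space (spherical_measure T (prod_root T))"
    unfolding prod
  proof (intro exI[of _ op_measure] conjI ballI allI impI)
    fix f \<alpha> assume f: "f \<in> joint_kernel T a"
    show "monomial_series \<alpha> f \<in> model_space T a" by (rule monomial_in_model_space[OF f])
    show "ennreal ((model_norm T a (monomial_series \<alpha> f))\<^sup>2) =
             (\<integral>\<^sup>+ p \<in> {0..1} \<times> sphere 0 1.
                ennreal (fst p ^ multi_abs \<alpha> * (cmod (zpow (snd p) \<alpha>))\<^sup>2)
              \<partial>quadratic_measure (vertices T) op_measure f)"
      by (simp only: model_norm_monomial weighted_norm_eq_integral[symmetric] weighted_norm_finite joint_kernel_l2[OF f])
  next
    fix A and g :: "'d set \<Rightarrow> ('d \<Rightarrow> 'v) \<Rightarrow> ('d \<Rightarrow> 'v) \<Rightarrow> complex"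
    assume "\<forall>F. \<forall>u\<in>\<Omega> F. g F u \<in> kernel_block T a u F"
    then show "op_measure A (block_sum \<Omega> g)
        = block_sum \<Omega> (\<lambda>F u v. complex_of_real (measure (vertex_measure u) A) * g F u v)"
      by (intro op_measure_block_sum \<Omega>) blast
  qed (rule operator_measure_op_measure op_measure_supported prob)+
  \<comment> \<open>The radial measures live on [0,1], so \<open>b = 1\<close>.\<close>
  then show ?thesis
    unfolding representing_measure_def
    by (intro conjI exI[of _ "1::real"])
       (simp_all add: fin, simp_all add: radial_measure_eq spherical_measure_eq)
qed

end

theorem corollary2p18:
  fixes T :: "'d::finite \<Rightarrow> 'v pair_pre_digraph"
    and a :: nat
    and \<Omega> :: "'d set \<Rightarrow> ('d \<Rightarrow> 'v) set"
  assumes "\<And>j. rooted_directed_tree (T j)"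
    and "\<And>j. countably_infinite_tree (T j)"
    and "\<And>j. leafless (T j)"
    and "\<And>j. locally_finite (T j)"
    and "finite_joint_branching_index T"
    and "class_representatives T \<Omega>"
    and "0 < a" and "a < CARD('d)"
  shows "\<exists>\<rho> \<nu>. representing_measure T (real a) \<Omega> \<rho> \<nu> \<and>
           (\<forall>F. \<forall>u\<in>\<Omega> F.
              (\<forall>s\<in>{0..1}. 0 \<le> omega CARD('d) a (multi_abs (prod_depth T u)) s) \<and>
              \<rho> u = radial_measure T a u \<and>
              \<nu> u = spherical_measure T u)"
proof -
  interpret multishift_model T a
    using assms by unfold_locales
  show ?thesis
    using representing_measure[OF assms(6)] omega_nonneg[OF assms(7,8)] by blast
qed

end
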